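(* Let $\Gamma\curvearrowright X$ be a Borel action of a finitely generated group $\Gamma$ on a standard Borel space $X$. Suppose that the asymptotic separation index of the action $\Gamma\curvearrowright X$ is finite. Let $A,B\subseteq X$ be Borel sets, at least one of which is $\Gamma$-paradoxical. The following statements are equivalent: (i) $A\preccurlyeq_\Gamma B$; (ii) $A$ is equidecomposable with a Borel subset of $B$ using Borel pieces; (iii) $A$ can be covered by finitely many $\Gamma$-translates of $B$. In particular, if $A\approx_\Gamma B$, then there is an equidecomposition of $A$ and $B$ using Borel pieces.
   Context: An action of $\Gamma$ on $X$ is Borel if for each $\gamma\in\Gamma$ the map $x\mapsto\gamma\cdot x$ is Borel. A $\Gamma$-translate of $A\subseteq X$ is a set of the form $\gamma\cdot A$, $\gamma\in\Gamma$. Two sets $A,B\subseteq X$ are equidecomposable by $\Gamma$, written $A\approx_\Gamma B$, if for some $k\in\mathbb{N}$ there are partitions $A=A_1\sqcup\dots\sqcup A_k$ and $B=B_1\sqcup\dots\sqcup B_k$ such that each $B_i$ is a $\Gamma$-translate of $A_i$. The tuple $(A_1,\dots,A_k,B_1,\dots,B_k)$ is an equidecomposition of $A$ and $B$, and the sets $A_i,B_i$ are its pieces. $A$ is subequivalent to $B$, written $A\preccurlyeq_\Gamma B$, if $A$ is equidecomposable by $\Gamma$ with a subset of $B$. A set $A$ is $\Gamma$-paradoxical if there is a partition $A=A_0\sqcup A_1$ with $A\approx_\Gamma A_0$ and $A\approx_\Gamma A_1$ (arbitrary, not necessarily Borel, pieces allowed). Asymptotic separation index: For a finite generating set $S$ of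 $\Gamma$, the Schreier graph $\mathsf{Sch}(X,\Gamma,S)$ is the simple graph with vertex set $X$ and edge set $\{\{x,\sigma\cdot x\}: x\in X,\ \sigma\in S,\ x\ne\sigma\cdot x\}$. The asymptotic separation index of $\Gamma\curvearrowright X$ is $\mathsf{asi}(\Gamma\curvearrowright X)=\mathsf{asi}(\mathsf{Sch}(X,\Gamma,S))$ for any (equivalently, every) finite generating set $S$, where for a simple locally finite Borel graph $G$ (i.e. one whose vertex set is standard Borel, whose edge relation is Borel, and all of whose vertices have finite degree), $\mathsf{asi}(G)$ is the smallest $s\in\mathbb{N}$ such that for every $k\in\mathbb{N}$ the vertex set of $G$ can be covered by $s+1$ Borel $G^k$-finite sets, and $\mathsf{asi}(G)=\infty$ if no such $s$ exists. Here $G^k$ is the simple graph on the same vertex set in which $\{x,y\}$ is an edge iff $0<\mathrm{dist}_G(x,y)\le k$, and a set $Y$ of vertices of a graph $H$ is $H$-finite if every connected component of the induced subgraph $H[Y]$ is finite. *)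

theory Defs
  imports
    "HOL-Analysis.Analysis"
    "HOL-Library.Extended_Nat"
    "HOL-Algebra.Generated_Groups"
    "HOL-Algebra.Group_Action"
begin

section \<open>Borel actions of finitely generated groups\<close>

text \<open>The topology is existentially quantified: a standard Borel space carries only its
  \<open>\<sigma>\<close>-algebra, which is required to be generated by the open sets of some Polish topology.\<close>

definition standard_borel_space :: "'x measure \<Rightarrow> bool" where
  "standard_borel_space X \<longleftrightarrow>
     (\<exists>T. topspace T = space X \<and> completely_metrizable_space T \<and> separable_space T \<and>
          sets X = sigma_sets (space X) {U. openin T U})"

definition borel_action ::
  "('g, 'm) monoid_scheme \<Rightarrow> 'x measure \<Rightarrow> ('g \<Rightarrow> 'x \<Rightarrow> 'x) \<Rightarrow> bool" where
  "borel_action \<Gamma> X \<phi> \<longleftrightarrow>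
     group_action \<Gamma> (space X) \<phi> \<and> (\<forall>\<gamma>\<in>carrier \<Gamma>. \<phi> \<gamma> \<in> X \<rightarrow>\<^sub>M X)"

definition finite_generating_set :: "('g, 'm) monoid_scheme \<Rightarrow> 'g set \<Rightarrow> bool" where
  "finite_generating_set \<Gamma> S \<longleftrightarrow> finite S \<and> S \<subseteq> carrier \<Gamma> \<and> generate \<Gamma> S = carrier \<Gamma>"

definition finitely_generated_group :: "('g, 'm) monoid_scheme \<Rightarrow> bool" where
  "finitely_generated_group \<Gamma> \<longleftrightarrow> group \<Gamma> \<and> (\<exists>S. finite_generating_set \<Gamma> S)"

section \<open>Equidecompositions\<close>

text \<open>Pieces may be empty, which does not affect the resulting relation.\<close>

definition indexed_partition :: "nat \<Rightarrow> (nat \<Rightarrow> 'x set) \<Rightarrow> 'x set \<Rightarrow> bool" where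
  "indexed_partition k P A \<longleftrightarrow> disjoint_family_on P {..<k} \<and> (\<Union>i<k. P i) = A"

definition equidecomposition ::
  "('g, 'm) monoid_scheme \<Rightarrow> ('g \<Rightarrow> 'x \<Rightarrow> 'x) \<Rightarrow>
   nat \<Rightarrow> (nat \<Rightarrow> 'x set) \<Rightarrow> (nat \<Rightarrow> 'x set) \<Rightarrow> 'x set \<Rightarrow> 'x set \<Rightarrow> bool" where
  "equidecomposition \<Gamma> \<phi> k P Q A B \<longleftrightarrow>
     indexed_partition k P A \<and> indexed_partition k Q B \<and>
     (\<forall>i<k. \<exists>\<gamma>\<in>carrier \<Gamma>. Q i = \<phi> \<gamma> ` P i)"

definition equidecomposable ::
  "('g, 'm) monoid_scheme \<Rightarrow> ('g \<Rightarrow> 'x \<Rightarrow> 'x) \<Rightarrow> 'x set \<Rightarrow> 'x set \<Rightarrow> bool" where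
  "equidecomposable \<Gamma> \<phi> A B \<longleftrightarrow> (\<exists>k P Q. equidecomposition \<Gamma> \<phi> k P Q A B)"

definition borel_equidecomposable ::
  "('g, 'm) monoid_scheme \<Rightarrow> 'x measure \<Rightarrow> ('g \<Rightarrow> 'x \<Rightarrow> 'x) \<Rightarrow> 'x set \<Rightarrow> 'x set \<Rightarrow> bool" where
  "borel_equidecomposable \<Gamma> X \<phi> A B \<longleftrightarrow>
     (\<exists>k P Q. equidecomposition \<Gamma> \<phi> k P Q A B \<and> (\<forall>i<k. P i \<in> sets X \<and> Q i \<in> sets X))"

definition subequivalent ::
  "('g, 'm) monoid_scheme \<Rightarrow> ('g \<Rightarrow> 'x \<Rightarrow> 'x) \<Rightarrow> 'x set \<Rightarrow> 'x set \<Rightarrow> bool" where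
  "subequivalent \<Gamma> \<phi> A B \<longleftrightarrow> (\<exists>B'\<subseteq>B. equidecomposable \<Gamma> \<phi> A B')"

definition paradoxical ::
  "('g, 'm) monoid_scheme \<Rightarrow> ('g \<Rightarrow> 'x \<Rightarrow> 'x) \<Rightarrow> 'x set \<Rightarrow> bool" where
  "paradoxical \<Gamma> \<phi> A \<longleftrightarrow>
     (\<exists>A0 A1. A0 \<union> A1 = A \<and> A0 \<inter> A1 = {} \<and>
        equidecomposable \<Gamma> \<phi> A A0 \<and> equidecomposable \<Gamma> \<phi> A A1)"

section \<open>Simple graphs and the asymptotic separation index\<close>

text \<open>A simple graph is given by its vertex set \<open>V\<close> and its set \<open>E\<close> of edges, each edge being a
  two-element subset of \<open>V\<close>. Walks are nonempty lists of vertices; a walk \<open>p\<close> has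
  \<open>length p - 1\<close> edges.\<close>

definition graph_walk :: "'x set \<Rightarrow> 'x set set \<Rightarrow> 'x \<Rightarrow> 'x list \<Rightarrow> 'x \<Rightarrow> bool" where
  "graph_walk V E x p y \<longleftrightarrow>
     p \<noteq> [] \<and> hd p = x \<and> last p = y \<and> set p \<subseteq> V \<and> successively (\<lambda>u v. {u, v} \<in> E) p"

text \<open>The infimum over the empty set is \<open>\<infinity>\<close>, the distance between different components.\<close>

definition graph_dist :: "'x set \<Rightarrow> 'x set set \<Rightarrow> 'x \<Rightarrow> 'x \<Rightarrow> enat" where
  "graph_dist V E x y = Inf {enat (length p - 1) | p. graph_walk V E x p y}"

definition power_edges :: "'x set \<Rightarrow> 'x set set \<Rightarrow> nat \<Rightarrow> 'x set set" where
  "power_edges V E k =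
     {{x, y} | x y. x \<in> V \<and> y \<in> V \<and> 0 < graph_dist V E x y \<and> graph_dist V E x y \<le> enat k}"

definition graph_component :: "'x set \<Rightarrow> 'x set set \<Rightarrow> 'x \<Rightarrow> 'x set" where
  "graph_component V E x = {y \<in> V. \<exists>p. graph_walk V E x p y}"

definition induced_edges :: "'x set set \<Rightarrow> 'x set \<Rightarrow> 'x set set" where
  "induced_edges E Y = {e \<in> E. e \<subseteq> Y}"

definition graph_finite :: "'x set set \<Rightarrow> 'x set \<Rightarrow> bool" where
  "graph_finite E Y \<longleftrightarrow> (\<forall>x\<in>Y. finite (graph_component Y (induced_edges E Y) x))"

text \<open>The vertex set is \<open>space X\<close>, and \<open>X\<close> supplies the Borel structure. The infimum over the empty
  set is \<open>\<infinity>\<close>. The notion is meant for locally finite Borel graphs, such as the Schreier graphs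
  of Borel actions below.\<close>

definition asi_graph :: "'x measure \<Rightarrow> 'x set set \<Rightarrow> enat" where
  "asi_graph X E =
     Inf {enat s | s. \<forall>k. \<exists>U :: nat \<Rightarrow> 'x set.
            (\<forall>i\<le>s. U i \<in> sets X \<and> graph_finite (power_edges (space X) E k) (U i)) \<and>
            space X = (\<Union>i\<le>s. U i)}"

definition schreier_edges :: "'x set \<Rightarrow> ('g \<Rightarrow> 'x \<Rightarrow> 'x) \<Rightarrow> 'g set \<Rightarrow> 'x set set" where
  "schreier_edges V \<phi> S = {{x, \<phi> \<sigma> x} | x \<sigma>. x \<in> V \<and> \<sigma> \<in> S \<and> x \<noteq> \<phi> \<sigma> x}"

text \<open>The value does not depend on the chosen generating set; see \<open>asi_action_eq\<close> below.\<close>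

definition asi_action ::
  "('g, 'm) monoid_scheme \<Rightarrow> 'x measure \<Rightarrow> ('g \<Rightarrow> 'x \<Rightarrow> 'x) \<Rightarrow> enat" where
  "asi_action \<Gamma> X \<phi> =
     asi_graph X (schreier_edges (space X) \<phi> (SOME S. finite_generating_set \<Gamma> S))"

subsection \<open>Independence of the generating set\<close>

lemma graph_walk_trans:
  assumes "graph_walk V E x p y" "graph_walk V E y q z"
  shows "graph_walk V E x (p @ tl q) z"
proof (cases "tl q")
  case Nil
  with assms show ?thesis
    by (cases q) (auto simp: graph_walk_def)
next
  case (Cons a r)
  with assms show ?thesis
    by (cases q) (auto simp: graph_walk_def successively_append_iff)
qed

lemma graph_walk_rev: "graph_walk V E x p y \<Longrightarrow> graph_walk V E y (rev p) x"
  by (auto simp: graph_walk_def hd_rev last_rev insert_commute)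

definition reach :: "'x set \<Rightarrow> 'x set set \<Rightarrow> nat \<Rightarrow> 'x \<Rightarrow> 'x \<Rightarrow> bool" where
  "reach V E n x y \<longleftrightarrow> (\<exists>p. graph_walk V E x p y \<and> length p \<le> Suc n)"

lemma reach_refl: "x \<in> V \<Longrightarrow> reach V E n x x"
  unfolding reach_def by (rule exI[of _ "[x]"]) (auto simp: graph_walk_def)

lemma reach_edge: "x \<in> V \<Longrightarrow> y \<in> V \<Longrightarrow> {x, y} \<in> E \<Longrightarrow> reach V E 1 x y"
  unfolding reach_def by (rule exI[of _ "[x, y]"]) (auto simp: graph_walk_def)

lemma reach_sym: "reach V E n x y \<Longrightarrow> reach V E n y x"
  unfolding reach_def by (metis graph_walk_rev length_rev)

lemma reach_trans:
  assumes "reach V E m x y" "reach V E n y z"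
  shows "reach V E (m + n) x z"
proof -
  obtain p q where pq: "graph_walk V E x p y" "graph_walk V E y q z"
    "length p \<le> Suc m" "length q \<le> Suc n"
    using assms by (auto simp: reach_def)
  have "length (p @ tl q) \<le> Suc (m + n)"
    using pq by auto
  then show ?thesis
    using graph_walk_trans[OF pq(1,2)] unfolding reach_def by blast
qed

lemma reach_mono: "reach V E m x y \<Longrightarrow> m \<le> n \<Longrightarrow> reach V E n x y"
  unfolding reach_def by (meson Suc_le_mono order_trans)

lemma graph_dist_le_iff: "graph_dist V E x y \<le> enat n \<longleftrightarrow> reach V E n x y"
proof
  let ?D = "{enat (length p - 1) | p. graph_walk V E x p y}"
  assume le: "graph_dist V E x y \<le> enat n"
  have "?D \<noteq> {}"
  proof
    assume "?D = {}"
    then have "graph_dist V E x y = \<infinity>"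
      unfolding graph_dist_def Inf_enat_def by (simp only: simp_thms if_True)
    with le show False
      by simp
  qed
  then obtain d where "d \<in> ?D"
    by blast
  then have "(LEAST d. d \<in> ?D) \<in> ?D"
    by (rule LeastI)
  then have "graph_dist V E x y \<in> ?D"
    using \<open>?D \<noteq> {}\<close> unfolding graph_dist_def Inf_enat_def by (simp only: if_False)
  then obtain p where "graph_walk V E x p y" "graph_dist V E x y = enat (length p - 1)"
    by blast
  with le show "reach V E n x y"
    unfolding reach_def by (intro exI[of _ p]) simp
next
  assume "reach V E n x y"
  then obtain p where p: "graph_walk V E x p y" "length p \<le> Suc n"
    by (auto simp: reach_def)
  have "graph_dist V E x y \<le> enat (length p - 1)"
    unfolding graph_dist_def using p(1) by (intro Inf_lower) blast
  also have "\<dots> \<le> enat n"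
    using p(2) by simp
  finally show "graph_dist V E x y \<le> enat n" .
qed

lemma graph_dist_pos_iff:
  assumes "x \<in> V"
  shows "0 < graph_dist V E x y \<longleftrightarrow> x \<noteq> y"
proof -
  have "graph_dist V E x y \<le> 0 \<longleftrightarrow> reach V E 0 x y"
    using graph_dist_le_iff[of V E x y 0] by (simp add: zero_enat_def)
  also have "\<dots> \<longleftrightarrow> x = y"
  proof
    assume "reach V E 0 x y"
    then obtain p where "graph_walk V E x p y" "length p \<le> Suc 0"
      by (auto simp: reach_def)
    then show "x = y"
      by (cases p) (auto simp: graph_walk_def)
  qed (use reach_refl[OF assms] in auto)
  finally show ?thesis
    by (simp add: zero_less_iff_neq_zero)
qed

lemma graph_walk_refine:
  assumes "\<And>u v. {u, v} \<in> E \<Longrightarrow> u \<in> V \<Longrightarrow> v \<in> V \<Longrightarrow> reach V E' c u v"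
    and "graph_walk V E x p y"
  shows "reach V E' (c * (length p - 1)) x y"
  using assms(2)
proof (induction p arbitrary: x)
  case Nil
  then show ?case
    by (simp add: graph_walk_def)
next
  case (Cons a p)
  show ?case
  proof (cases p)
    case Nil
    with Cons.prems show ?thesis
      by (auto simp: graph_walk_def intro: reach_refl)
  next
    case (Cons b q)
    with Cons.prems have "graph_walk V E b p y" "{a, b} \<in> E" "a \<in> V" "b \<in> V" "x = a"
      by (auto simp: graph_walk_def)
    then have "reach V E' (c + c * (length p - 1)) x y"
      using reach_trans[OF assms(1) Cons.IH] by simp
    with Cons show ?thesis
      by simp
  qed
qed

lemma power_edges_refine:
  assumes "\<And>u v. {u, v} \<in> E \<Longrightarrow> u \<in> V \<Longrightarrow> v \<in> V \<Longrightarrow> reach V E' c u v"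
  shows "power_edges V E k \<subseteq> power_edges V E' (c * k)"
proof
  fix e assume "e \<in> power_edges V E k"
  then obtain x y where xy: "e = {x, y}" "x \<in> V" "y \<in> V" "0 < graph_dist V E x y"
    "reach V E k x y"
    unfolding power_edges_def graph_dist_le_iff by blast
  then obtain p where p: "graph_walk V E x p y" "length p - 1 \<le> k"
    by (auto simp: reach_def)
  have "reach V E' (c * k) x y"
    by (rule reach_mono[OF graph_walk_refine[OF assms p(1)] mult_le_mono2[OF p(2)]])
  moreover have "0 < graph_dist V E' x y"
    using xy(2,4) graph_dist_pos_iff by metis
  ultimately show "e \<in> power_edges V E' (c * k)"
    unfolding power_edges_def graph_dist_le_iff using xy by blast
qed

lemma graph_finite_antimono:
  assumes "E \<subseteq> E'" "graph_finite E' Y"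
  shows "graph_finite E Y"
  unfolding graph_finite_def
proof
  fix x assume "x \<in> Y"
  have "graph_walk Y (induced_edges E' Y) x p y" if "graph_walk Y (induced_edges E Y) x p y" for p y
    using that assms(1) successively_mono[of "\<lambda>u v. {u, v} \<in> induced_edges E Y" p
        "\<lambda>u v. {u, v} \<in> induced_edges E' Y"]
    unfolding graph_walk_def induced_edges_def by blast
  then have "graph_component Y (induced_edges E Y) x \<subseteq> graph_component Y (induced_edges E' Y) x"
    by (auto simp: graph_component_def)
  with assms(2) \<open>x \<in> Y\<close> show "finite (graph_component Y (induced_edges E Y) x)"
    by (auto simp: graph_finite_def intro: finite_subset)
qed

lemma asi_graph_refine:
  assumes "\<And>u v. {u, v} \<in> E \<Longrightarrow> u \<in> space X \<Longrightarrow> v \<in> space X \<Longrightarrow> reach (space X) E' c u v"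
  shows "asi_graph X E \<le> asi_graph X E'"
  unfolding asi_graph_def
proof (rule Inf_superset_mono, safe)
  fix s
  assume *: "\<forall>k. \<exists>U :: nat \<Rightarrow> 'a set.
            (\<forall>i\<le>s. U i \<in> sets X \<and> graph_finite (power_edges (space X) E' k) (U i)) \<and>
            space X = (\<Union>i\<le>s. U i)"
  have "\<exists>U :: nat \<Rightarrow> 'a set.
            (\<forall>i\<le>s. U i \<in> sets X \<and> graph_finite (power_edges (space X) E k) (U i)) \<and>
            space X = (\<Union>i\<le>s. U i)" for k
  proof -
    obtain U where U: "\<forall>i\<le>s. U i \<in> sets X \<and> graph_finite (power_edges (space X) E' (c * k)) (U i)"
      "space X = (\<Union>i\<le>s. U i)"
      using spec[OF *, of "c * k"] by (elim exE conjE)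
    have "graph_finite (power_edges (space X) E k) (U i)" if "i \<le> s" for i
      using U(1) that graph_finite_antimono[OF power_edges_refine[OF assms]] by simp
    with U show ?thesis
      by (intro exI[of _ U]) simp
  qed
  then show "\<exists>s'. enat s = enat s' \<and> (\<forall>k. \<exists>U :: nat \<Rightarrow> 'a set.
            (\<forall>i\<le>s'. U i \<in> sets X \<and> graph_finite (power_edges (space X) E k) (U i)) \<and>
            space X = (\<Union>i\<le>s'. U i))"
    by blast
qed

lemma schreier_reach:
  assumes act: "group_action \<Gamma> V \<phi>" and T: "T \<subseteq> carrier \<Gamma>" and g: "g \<in> generate \<Gamma> T"
  shows "\<exists>n. \<forall>x\<in>V. reach V (schreier_edges V \<phi> T) n x (\<phi> g x)"
  using g
proof (induction rule: generate.induct)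
  interpret group_action \<Gamma> V \<phi>
    by fact
  interpret group \<Gamma>
    using group_hom group_hom.axioms(1) by auto
  have step: "reach V (schreier_edges V \<phi> T) 1 x (\<phi> h x)" if "h \<in> T" "x \<in> V" for h x
  proof (cases "\<phi> h x = x")
    case True
    with that show ?thesis
      by (simp add: reach_refl)
  next
    case False
    have "{x, \<phi> h x} \<in> schreier_edges V \<phi> T"
      unfolding schreier_edges_def using False that by fastforce
    moreover have "\<phi> h x \<in> V"
      using that T element_image by blast
    ultimately show ?thesis
      using that reach_edge by metis
  qed
  {
    case one
    show ?case
      using id_eq_one reach_refl by (metis restrict_apply')
  next
    case (incl h)
    then show ?case
      using step by blast
  next
    case (inv h)
    have "reach V (schreier_edges V \<phi> T) 1 x (\<phi> (inv\<^bsub>\<Gamma>\<^esub> h) x)" if "x \<in> V" for x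
    proof -
      have h: "h \<in> carrier \<Gamma>" "inv\<^bsub>\<Gamma>\<^esub> h \<in> carrier \<Gamma>"
        using inv T by auto
      have "\<phi> (inv\<^bsub>\<Gamma>\<^esub> h) x \<in> V"
        using h that element_image by blast
      moreover have "\<phi> h (\<phi> (inv\<^bsub>\<Gamma>\<^esub> h) x) = x"
        using orbit_sym_aux[OF h(2) that refl] h by simp
      ultimately show ?thesis
        using step[OF inv] reach_sym by metis
    qed
    then show ?case
      by blast
  next
    case (eng h1 h2)
    have h: "h1 \<in> carrier \<Gamma>" "h2 \<in> carrier \<Gamma>"
      using eng(1,2) generate_in_carrier[OF T] by auto
    obtain n1 n2 where n: "\<forall>x\<in>V. reach V (schreier_edges V \<phi> T) n1 x (\<phi> h1 x)"
      "\<forall>x\<in>V. reach V (schreier_edges V \<phi> T) n2 x (\<phi> h2 x)"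
      using eng by blast
    have "reach V (schreier_edges V \<phi> T) (n2 + n1) x (\<phi> (h1 \<otimes>\<^bsub>\<Gamma>\<^esub> h2) x)" if "x \<in> V" for x
    proof -
      have "\<phi> h2 x \<in> V"
        using h that element_image by blast
      then show ?thesis
        using n that composition_rule[OF that h] reach_trans by metis
    qed
    then show ?case
      by blast
  }
qed

lemma asi_schreier_le:
  assumes act: "group_action \<Gamma> (space X) \<phi>"
    and S: "finite_generating_set \<Gamma> S" and T: "finite_generating_set \<Gamma> T"
  shows "asi_graph X (schreier_edges (space X) \<phi> S) \<le> asi_graph X (schreier_edges (space X) \<phi> T)"
proof -
  let ?V = "space X" and ?E = "schreier_edges (space X) \<phi> T"
  have "\<forall>\<sigma>\<in>S. \<exists>n. \<forall>x\<in>?V. reach ?V ?E n x (\<phi> \<sigma> x)"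
    using S T schreier_reach[OF act] by (auto simp: finite_generating_set_def)
  then obtain n where n: "\<And>\<sigma> x. \<sigma> \<in> S \<Longrightarrow> x \<in> ?V \<Longrightarrow> reach ?V ?E (n \<sigma>) x (\<phi> \<sigma> x)"
    by metis
  define c where "c = sum n S"
  have c: "reach ?V ?E c x (\<phi> \<sigma> x)" if "\<sigma> \<in> S" "x \<in> ?V" for \<sigma> x
    using n[OF that] S member_le_sum[of \<sigma> S n] that
    by (auto simp: c_def finite_generating_set_def intro: reach_mono)
  show ?thesis
  proof (rule asi_graph_refine[where c = c])
    fix u v assume "{u, v} \<in> schreier_edges ?V \<phi> S" "u \<in> ?V" "v \<in> ?V"
    then obtain x \<sigma> where x: "{u, v} = {x, \<phi> \<sigma> x}" "x \<in> ?V" "\<sigma> \<in> S"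
      unfolding schreier_edges_def by blast
    then show "reach ?V ?E c u v"
      using c[OF x(3,2)] by (auto simp: doubleton_eq_iff intro: reach_sym)
  qed
qed

lemma asi_action_eq:
  assumes "group_action \<Gamma> (space X) \<phi>" "finite_generating_set \<Gamma> S"
  shows "asi_action \<Gamma> X \<phi> = asi_graph X (schreier_edges (space X) \<phi> S)"
proof -
  have "finite_generating_set \<Gamma> (SOME S. finite_generating_set \<Gamma> S)"
    using assms(2) by (rule someI)
  then show ?thesis
    unfolding asi_action_def using assms by (intro antisym asi_schreier_le)
qed

end

(* (i) implies (iii) is immediate. Given (iii), paradoxicality of A or B makes A expand into B:
   for every N there is a finite set F of group elements such that every finite S in A satisfies
   N |S| <= |F S cap B|.

   Let U_0, ..., U_s be Borel sets covering X that are G^k-finite for a large k. The points of A are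
   matched in the order U_0, ..., U_s. Before stage j each point of A in U_0, ..., U_(j-1) has
   2^(s+1-j) points of B reserved for it, arranged in pairs. At stage j, the new points have to
   reserve 2^(s-j) points each while hitting every pair at most once; then each old point still
   keeps one point of every pair. By expansion and Hall's theorem, applied to B with the points of
   each pair identified, this can be done on each of the finite components of U_j, and since these
   are far apart the choices do not interfere. Choosing a solution on each finite component can be
   done in a Borel way. After stage s each point of A retains a point of B of its own. The last claim
   is a Borel Schroeder-Bernstein argument. *)
theory Submission
  imports Defs
begin

text \<open>The difficulty is that repairing an ordinary matching when a new piece
  \<open>U_j\<close> is added may propagate along paths of unbounded length, and then no bounded
  scale \<open>k\<close> makes the repairs independent. Reserves remove this: an old point reacts
  only by choosing within pairs of its own, so two new points interact only by hitting the same
  point or the two points of one pair. Such an interaction is a word in four letters from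
  \<open>F\<close> and its inverses, and \<open>k\<close> need only bound these words in the
  generators. This dictates the order of choices: the bound \<open>s\<close>, which is the same for
  all scales; the expansion factor 2^(s+1), because s+1 halvings must leave one point; the moves
  \<open>F\<close>; the scale \<open>k\<close>; and only then the cover. Identifying the two points
  of a pair at most halves a set, which is why stage j asks for expansion 2 * 2^(s-j) although it
  reserves only 2^(s-j) points for each new point.\<close>

section \<open>Preliminaries\<close>

text \<open>Rado's proof: shrink a set \<open>N i\<close> with two elements \<open>x \<noteq> y\<close>. If removing \<open>x\<close> violates the
  condition at \<open>J\<close> and removing \<open>y\<close> violates it at \<open>K\<close>, then the condition for \<open>N\<close> at \<open>J \<union> K\<close> and
  \<open>J \<inter> K - {i}\<close> gives a contradiction by counting.\<close>

lemma finite_hall: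
  assumes "finite I" "\<And>i. i \<in> I \<Longrightarrow> finite (N i)"
    and "\<And>J. J \<subseteq> I \<Longrightarrow> card J \<le> card (\<Union>(N ` J))"
  shows "\<exists>h. inj_on h I \<and> (\<forall>i\<in>I. h i \<in> N i)"
  using assms(2,3)
proof (induction "\<Sum>i\<in>I. card (N i)" arbitrary: N rule: less_induct)
  case less
  show ?case
  proof (cases "\<forall>i\<in>I. card (N i) = 1")
    case True
    then have "\<forall>i\<in>I. \<exists>y. N i = {y}"
      by (simp add: card_1_singleton_iff)
    then obtain h where h: "\<And>i. i \<in> I \<Longrightarrow> N i = {h i}"
      by metis
    have "inj_on h I"
    proof (rule inj_onI)
      fix i j assume ij: "i \<in> I" "j \<in> I" "h i = h j"
      then have "card {i, j} \<le> card {h i}"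
        using less.prems(2)[of "{i, j}"] h by simp
      then show "i = j"
        by (cases "i = j") auto
    qed
    with h show ?thesis
      by blast
  next
    case False
    then obtain i where i: "i \<in> I" "card (N i) \<noteq> 1"
      by blast
    then have "card (N i) \<ge> 2"
      using less.prems(2)[of "{i}"] by simp
    then obtain x y where xy: "x \<in> N i" "y \<in> N i" "x \<noteq> y"
      by (metis card_2_iff' obtain_subset_with_card_n subsetD)
    define M where "M z = N(i := N i - {z})" for z
    have fin: "finite (M z j)" if "j \<in> I" for z j
      using less.prems(1)[OF that] less.prems(1)[OF i(1)] by (simp add: M_def)
    have smaller: "(\<Sum>j\<in>I. card (M z j)) < (\<Sum>j\<in>I. card (N j))" if "z \<in> N i" for z
    proof (rule sum_strict_mono_ex1[OF assms(1)])
      show "\<forall>j\<in>I. card (M z j) \<le> card (N j)"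
        using less.prems(1) by (auto simp: M_def intro: card_mono)
      have "card (N i - {z}) < card (N i)"
        using card_Diff1_less[OF less.prems(1)[OF i(1)] that] .
      then show "\<exists>j\<in>I. card (M z j) < card (N j)"
        using i(1) by (intro bexI[of _ i]) (simp_all add: M_def)
    qed
    have sub: "M z j \<subseteq> N j" for z j
      by (auto simp: M_def)
    show ?thesis
    proof (cases "\<exists>z\<in>{x, y}. \<forall>J\<subseteq>I. card J \<le> card (\<Union>(M z ` J))")
      case True
      then obtain z where z: "z \<in> N i" "\<forall>J\<subseteq>I. card J \<le> card (\<Union>(M z ` J))"
        using xy by blast
      obtain h where "inj_on h I" "\<forall>i\<in>I. h i \<in> M z i"
        using less.hyps[OF smaller[OF z(1)] fin] z(2) by blast
      then show ?thesis
        using sub by blast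
    next
      case False
      then obtain J K where J: "J \<subseteq> I" "card (\<Union>(M x ` J)) < card J"
        and K: "K \<subseteq> I" "card (\<Union>(M y ` K)) < card K"
        by (auto simp: not_le)
      let ?P = "\<Union>(M x ` J)" and ?Q = "\<Union>(M y ` K)"
      have iJ: "i \<in> J"
      proof (rule ccontr)
        assume "i \<notin> J"
        then have "?P = \<Union>(N ` J)"
          by (auto simp: M_def)
        then show False
          using less.prems(2)[OF J(1)] J(2) by simp
      qed
      have iK: "i \<in> K"
      proof (rule ccontr)
        assume "i \<notin> K"
        then have "?Q = \<Union>(N ` K)"
          by (auto simp: M_def)
        then show False
          using less.prems(2)[OF K(1)] K(2) by simp
      qed
      have fJK: "finite J" "finite K"
        using J(1) K(1) assms(1) finite_subset by blast+
      have fPQ: "finite ?P" "finite ?Q"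
        using J(1) K(1) fJK fin by (auto intro!: finite_UN_I)
      have "card (J \<union> K) \<le> card (\<Union>(N ` (J \<union> K)))"
        using less.prems(2)[of "J \<union> K"] J(1) K(1) by simp
      also have "\<Union>(N ` (J \<union> K)) \<subseteq> ?P \<union> ?Q"
      proof
        fix w assume "w \<in> \<Union>(N ` (J \<union> K))"
        then obtain j where j: "j \<in> J \<union> K" "w \<in> N j"
          by blast
        show "w \<in> ?P \<union> ?Q"
        proof (cases "j = i")
          case True
          then have "w \<in> M x i \<or> w \<in> M y i"
            using j(2) xy(3) by (auto simp: M_def)
          with iJ iK show ?thesis
            by blast
        next
          case False
          then have "w \<in> M x j" "w \<in> M y j"
            using j(2) by (auto simp: M_def)
          with j(1) show ?thesis
            by blast
        qed
      qed
      then have "card (\<Union>(N ` (J \<union> K))) \<le> card (?P \<union> ?Q)"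
        using fPQ by (intro card_mono) auto
      finally have 1: "card (J \<union> K) \<le> card (?P \<union> ?Q)" .
      have "card (J \<inter> K - {i}) \<le> card (\<Union>(N ` (J \<inter> K - {i})))"
        using less.prems(2)[of "J \<inter> K - {i}"] J(1) by blast
      also have "\<dots> \<le> card (?P \<inter> ?Q)"
      proof (rule card_mono)
        have "N j \<subseteq> M x j" "N j \<subseteq> M y j" if "j \<noteq> i" for j
          using that by (auto simp: M_def)
        then show "\<Union>(N ` (J \<inter> K - {i})) \<subseteq> ?P \<inter> ?Q"
          by blast
      qed (use fPQ in auto)
      finally have 2: "card (J \<inter> K) - 1 \<le> card (?P \<inter> ?Q)"
        using iJ iK by simp
      have "card (J \<inter> K) \<ge> 1"
        using iJ iK fJK by (simp add: Suc_le_eq card_gt_0_iff) blast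
      moreover have "card J + card K = card (J \<union> K) + card (J \<inter> K)"
        "card ?P + card ?Q = card (?P \<union> ?Q) + card (?P \<inter> ?Q)"
        using fJK fPQ by (auto intro: card_Un_Int)
      ultimately show ?thesis
        using 1 2 J(2) K(2) by linarith
    qed
  qed
qed

section \<open>Countable separation of points and countability of the group\<close>

text \<open>Balls of radius 1/(n+1) around a countable dense set suffice: a ball of radius less than
  half of \<open>d x y\<close> whose centre is close to \<open>x\<close> contains \<open>x\<close>
  but not \<open>y\<close>. Such a sequence is what makes equality and a linear order on the space
  Borel.\<close>

lemma standard_borel_separating_sequence:
  assumes "standard_borel_space X"
  shows "\<exists>V :: nat \<Rightarrow> 'x set. (\<forall>n. V n \<in> sets X) \<and>
    (\<forall>x\<in>space X. \<forall>y\<in>space X. x \<noteq> y \<longrightarrow> (\<exists>n. (x \<in> V n) \<noteq> (y \<in> V n)))"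
proof -
  obtain T where T: "topspace T = space X" "completely_metrizable_space T" "separable_space T"
    "sets X = sigma_sets (space X) {U. openin T U}"
    using assms unfolding standard_borel_space_def by blast
  obtain M d where "Metric_space M d" "T = Metric_space.mtopology M d"
    using completely_metrizable_imp_metrizable_space[OF T(2)] unfolding metrizable_space_def by blast
  then interpret Metric_space M d
    by simp
  note mtop = \<open>T = mtopology\<close>
  obtain C where C: "countable C" "C \<subseteq> M" "mtopology closure_of C = M"
    using T(3) unfolding mtop separable_space_def by auto
  \<comment> \<open>The empty set is added so that the family can be enumerated by
    \<open>nat\<close> even over an empty space.\<close>
  define \<B> where "\<B> = insert {} ((\<lambda>(c, n). mball c (inverse (real (Suc n)))) ` (C \<times> UNIV))"
  have "countable \<B>" "\<B> \<noteq> {}"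
    using C(1) by (auto simp: \<B>_def)
  then obtain V :: "nat \<Rightarrow> 'x set" where V: "range V = \<B>"
    using uncountable_def by metis
  have "openin T U" if "U \<in> \<B>" for U
    using that by (auto simp: \<B>_def mtop)
  then have "V n \<in> sets X" for n
    using V T(4) by (auto intro!: sigma_sets.Basic)
  moreover have "\<exists>n. (x \<in> V n) \<noteq> (y \<in> V n)" if xy: "x \<in> space X" "y \<in> space X" "x \<noteq> y" for x y
  proof -
    have M: "x \<in> M" "y \<in> M"
      using xy T(1) mtop by auto
    then have "d x y > 0"
      using xy(3) by simp
    then obtain n where n: "inverse (real (Suc n)) < d x y / 2"
      using reals_Archimedean half_gt_zero by blast
    define r where "r = inverse (real (Suc n))"
    have "r > 0" "2 * r < d x y"
      using n by (auto simp: r_def)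
    have "x \<in> mtopology closure_of C"
      using C(3) M by simp
    then obtain c where c: "c \<in> C" "c \<in> mball x r"
      unfolding metric_closure_of using \<open>r > 0\<close> by blast
    then have "x \<in> mball c r"
      using M C(2) commute by auto
    moreover have "y \<notin> mball c r"
      using c M C(2) triangle[of x c y] \<open>2 * r < d x y\<close> by auto
    moreover have "mball c r \<in> \<B>"
      unfolding \<B>_def r_def using c(1) by force
    then obtain m where "V m = mball c r"
      using V by (metis imageE)
    ultimately show ?thesis
      by blast
  qed
  ultimately show ?thesis
    by blast
qed

text \<open>Every element is the product of a word in the generators and their inverses, and there
  are countably many words. Countability of the group is what lets quantifiers over it preserve
  Borel predicates.\<close>

lemma (in group) countable_generate:
  assumes "countable S" "S \<subseteq> carrier G"
  shows "countable (generate G S)"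
proof -
  define W where "W = S \<union> m_inv G ` S"
  have "generate G S \<subseteq> (\<lambda>ws. foldr (\<otimes>) ws \<one>) ` lists W"
  proof
    fix h assume "h \<in> generate G S"
    then have "\<exists>ws\<in>lists W. h = foldr (\<otimes>) ws \<one>"
    proof (induction rule: generate.induct)
      case one
      show ?case
        by (rule bexI[of _ "[]"]) auto
    next
      case (incl h)
      then show ?case
        using assms(2) by (intro bexI[of _ "[h]"]) (auto simp: W_def)
    next
      case (inv h)
      then show ?case
        using assms(2) by (intro bexI[of _ "[inv h]"]) (auto simp: W_def)
    next
      case (eng h1 h2)
      then obtain ws vs where w: "ws \<in> lists W" "vs \<in> lists W"
        "h1 = foldr (\<otimes>) ws \<one>" "h2 = foldr (\<otimes>) vs \<one>"
        by blast
      have carr: "foldr (\<otimes>) us \<one> \<in> carrier G" if "us \<in> lists W" for us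
        using that assms(2) by (induction us) (auto simp: W_def)
      have "foldr (\<otimes>) us \<one> \<otimes> foldr (\<otimes>) vs \<one> = foldr (\<otimes>) (us @ vs) \<one>" if "us \<in> lists W" for us
        using that
      proof (induction rule: lists.induct)
        case (Cons u us)
        moreover have "u \<in> carrier G"
          using Cons.hyps(1) assms(2) by (auto simp: W_def)
        ultimately show ?case
          using carr[of us] carr[of vs] w(2) by (simp add: m_assoc)
      qed (use carr w in auto)
      with w show ?case
        by (intro bexI[of _ "ws @ vs"]) auto
    qed
    then show "h \<in> (\<lambda>ws. foldr (\<otimes>) ws \<one>) ` lists W"
      by blast
  qed
  moreover have "countable ((\<lambda>ws. foldr (\<otimes>) ws \<one>) ` lists W)"
    using assms(1) by (auto simp: W_def)
  ultimately show ?thesis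
    by (rule countable_subset)
qed

section \<open>Borel solutions of finite constraint problems\<close>

text \<open>The index set will be the carrier of the group or a finite set, inside a type that may
  be uncountable. Measurability is asked only for indices in that set, since only there the action
  is known to be Borel.\<close>

lemma pred_countable_bounded:
  assumes "countable I" "\<And>i. i \<in> I \<Longrightarrow> Measurable.pred M (P i)"
  shows "Measurable.pred M (\<lambda>x. \<forall>i\<in>I. P i x)" "Measurable.pred M (\<lambda>x. \<exists>i\<in>I. P i x)"
proof -
  have Bex: "Measurable.pred M (\<lambda>x. \<exists>i\<in>I. Q i x)"
    if "\<And>i. i \<in> I \<Longrightarrow> Measurable.pred M (Q i)" for Q
  proof -
    have "{x \<in> space M. \<exists>i\<in>I. Q i x} = (\<Union>i\<in>I. {x \<in> space M. Q i x})"
      by blast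
    also have "\<dots> \<in> sets M"
      using that by (intro sets.countable_UN''[OF assms(1)]) (simp add: pred_def)
    finally show ?thesis
      by (simp add: pred_def)
  qed
  show "Measurable.pred M (\<lambda>x. \<exists>i\<in>I. P i x)"
    by (rule Bex[OF assms(2)])
  have "Measurable.pred M (\<lambda>x. \<not> (\<exists>i\<in>I. \<not> P i x))"
    by (intro pred_intros_logic(2) Bex assms(2))
  then show "Measurable.pred M (\<lambda>x. \<forall>i\<in>I. P i x)"
    by simp
qed

text \<open>The topology is replaced by the separating sequence \<open>V\<close>, the form in which
  standard Borelness is used.\<close>

locale separated_borel_action = group_action \<Gamma> "space X" \<phi>
  for \<Gamma> :: "('g, 'm) monoid_scheme" (structure) and X :: "'x measure" and \<phi> +
  fixes V :: "nat \<Rightarrow> 'x set"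
  assumes countable_carrier: "countable (carrier \<Gamma>)"
    and act_measurable [measurable]: "\<gamma> \<in> carrier \<Gamma> \<Longrightarrow> \<phi> \<gamma> \<in> X \<rightarrow>\<^sub>M X"
    and V_sets [measurable]: "V n \<in> sets X"
    and V_separates: "x \<in> space X \<Longrightarrow> y \<in> space X \<Longrightarrow> x \<noteq> y \<Longrightarrow> \<exists>n. (x \<in> V n) \<noteq> (y \<in> V n)"
begin

sublocale group \<Gamma>
  using group_hom group_hom.axioms(1) by auto

lemma act_closed [simp]: "\<gamma> \<in> carrier \<Gamma> \<Longrightarrow> x \<in> space X \<Longrightarrow> \<phi> \<gamma> x \<in> space X"
  using element_image by blast

lemma act_one [simp]: "x \<in> space X \<Longrightarrow> \<phi> \<one> x = x"
  using id_eq_one by (metis restrict_apply')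

lemma act_mult [simp]:
  "\<gamma> \<in> carrier \<Gamma> \<Longrightarrow> \<delta> \<in> carrier \<Gamma> \<Longrightarrow> x \<in> space X \<Longrightarrow> \<phi> (\<gamma> \<otimes> \<delta>) x = \<phi> \<gamma> (\<phi> \<delta> x)"
  by (simp add: composition_rule)

lemma act_inv_act [simp]: "\<gamma> \<in> carrier \<Gamma> \<Longrightarrow> x \<in> space X \<Longrightarrow> \<phi> (inv \<gamma>) (\<phi> \<gamma> x) = x"
  using orbit_sym_aux by blast

lemma act_act_inv [simp]: "\<gamma> \<in> carrier \<Gamma> \<Longrightarrow> x \<in> space X \<Longrightarrow> \<phi> \<gamma> (\<phi> (inv \<gamma>) x) = x"
  using act_inv_act[of "inv \<gamma>" x] by simp

lemma act_image_sets:
  assumes "\<gamma> \<in> carrier \<Gamma>" "C \<in> sets X"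
  shows "\<phi> \<gamma> ` C \<in> sets X"
proof -
  have "\<phi> \<gamma> ` C = \<phi> (inv \<gamma>) -` C \<inter> space X"
  proof (intro equalityI subsetI)
    fix x assume "x \<in> \<phi> (inv \<gamma>) -` C \<inter> space X"
    then show "x \<in> \<phi> \<gamma> ` C"
      using assms(1) by (intro image_eqI[of _ _ "\<phi> (inv \<gamma>) x"]) auto
  qed (use assms sets.sets_into_space[OF assms(2)] in auto)
  then show ?thesis
    using assms measurable_sets[OF act_measurable] by simp
qed

text \<open>Since \<open>V\<close> separates points, equality is a countable conjunction of
  membership conditions.\<close>

lemma pred_eq:
  assumes [measurable]: "f \<in> M \<rightarrow>\<^sub>M X" "g \<in> M \<rightarrow>\<^sub>M X"
  shows "Measurable.pred M (\<lambda>x. f x = g x)"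
proof -
  have "Measurable.pred M (\<lambda>x. \<forall>n. (f x \<in> V n) = (g x \<in> V n))"
    by measurable
  moreover have "(\<forall>n. (f x \<in> V n) = (g x \<in> V n)) \<longleftrightarrow> f x = g x" if "x \<in> space M" for x
    using V_separates[OF measurable_space[OF assms(1) that] measurable_space[OF assms(2) that]] by auto
  ultimately show ?thesis
    by (simp cong: measurable_cong)
qed

section \<open>A Borel order and Borel relations along orbits\<close>

text \<open>A Borel linear order; it picks out one point of every finite class.\<close>

definition lex_less :: "'x \<Rightarrow> 'x \<Rightarrow> bool" where
  "lex_less x y \<longleftrightarrow> (\<exists>n. x \<notin> V n \<and> y \<in> V n \<and> (\<forall>k<n. x \<in> V k \<longleftrightarrow> y \<in> V k))"

lemma lex_less_trans: "lex_less x y \<Longrightarrow> lex_less y z \<Longrightarrow> lex_less x z"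
proof -
  assume "lex_less x y" "lex_less y z"
  then obtain n m where n: "x \<notin> V n" "y \<in> V n" "\<forall>k<n. x \<in> V k \<longleftrightarrow> y \<in> V k"
    and m: "y \<notin> V m" "z \<in> V m" "\<forall>k<m. y \<in> V k \<longleftrightarrow> z \<in> V k"
    by (auto simp: lex_less_def)
  have "n \<noteq> m"
    using n m by auto
  \<comment> \<open>At the smaller index only one of the two comparisons is decided; the other pair
    still agrees there.\<close>
  then have "x \<notin> V (min n m)" "z \<in> V (min n m)"
    using n m by (auto simp: min_def not_le)
  with n m show ?thesis
    unfolding lex_less_def by (intro exI[of _ "min n m"]) auto
qed

lemma lex_less_total:
  assumes "x \<in> space X" "y \<in> space X" "x \<noteq> y"
  shows "lex_less x y \<or> lex_less y x"
proof -
  define n where "n = (LEAST n. (x \<in> V n) \<noteq> (y \<in> V n))"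
  have "(x \<in> V n) \<noteq> (y \<in> V n)"
    unfolding n_def using V_separates[OF assms] by (rule LeastI_ex)
  moreover have "\<forall>k<n. (x \<in> V k) = (y \<in> V k)"
    unfolding n_def using not_less_Least by blast
  ultimately show ?thesis
    unfolding lex_less_def by blast
qed

lemma lex_less_irrefl: "\<not> lex_less x x"
  by (simp add: lex_less_def)

lemma pred_lex_less:
  assumes [measurable]: "f \<in> M \<rightarrow>\<^sub>M X" "g \<in> M \<rightarrow>\<^sub>M X"
  shows "Measurable.pred M (\<lambda>x. lex_less (f x) (g x))"
  unfolding lex_less_def by measurable

lemma ex_lex_least:
  assumes "finite K" "K \<noteq> {}"
  shows "\<exists>r\<in>K. \<forall>x\<in>K. \<not> lex_less x r"
proof -
  have "asymp_on K lex_less" "transp_on K lex_less"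
    using lex_less_trans lex_less_irrefl by (blast intro: asymp_onI transp_onI)+
  then show ?thesis
    using Finite_Set.bex_min_element[OF assms(1) _ _ assms(2), of lex_less] lex_less_irrefl by metis
qed

text \<open>Relations are only ever queried at two points of one orbit. Asking for Borelness along
  the pairs of translates of a single variable point turns this into a countable family of unary
  conditions, without a product space.\<close>

definition orbit_borel :: "('x \<Rightarrow> 'x \<Rightarrow> bool) \<Rightarrow> bool" where
  "orbit_borel R \<longleftrightarrow>
     (\<forall>\<gamma>\<in>carrier \<Gamma>. \<forall>\<delta>\<in>carrier \<Gamma>. Measurable.pred X (\<lambda>x. R (\<phi> \<gamma> x) (\<phi> \<delta> x)))"

lemma orbit_borelD:
  "orbit_borel R \<Longrightarrow> \<gamma> \<in> carrier \<Gamma> \<Longrightarrow> \<delta> \<in> carrier \<Gamma> \<Longrightarrow>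
    Measurable.pred X (\<lambda>x. R (\<phi> \<gamma> x) (\<phi> \<delta> x))"
  by (simp add: orbit_borel_def)

lemma orbit_borelD_one:
  assumes "orbit_borel R" "\<gamma> \<in> carrier \<Gamma>"
  shows "Measurable.pred X (\<lambda>x. R x (\<phi> \<gamma> x))"
  using orbit_borelD[OF assms(1) one_closed assms(2)] by (simp cong: measurable_cong)

text \<open>A class is described from its least point, the root, by a finite list of pairs of a group
  element and a label. There are countably many such lists, so the first one that describes a
  solution on the class depends on the root in a Borel way.\<close>

lemma borel_csp:
  fixes E :: "'x \<Rightarrow> 'x \<Rightarrow> bool" and R :: "'l \<Rightarrow> 'x \<Rightarrow> 'l \<Rightarrow> 'x \<Rightarrow> bool" and L :: "'l set"
  assumes D [measurable]: "D \<in> sets X"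
    and E_borel: "orbit_borel E"
    and E_refl: "\<And>x. x \<in> D \<Longrightarrow> E x x"
    and E_D: "\<And>x y. x \<in> D \<Longrightarrow> E x y \<Longrightarrow> y \<in> D"
    and E_sym: "\<And>x y. x \<in> D \<Longrightarrow> E x y \<Longrightarrow> E y x"
    and E_trans: "\<And>x y z. x \<in> D \<Longrightarrow> E x y \<Longrightarrow> E y z \<Longrightarrow> E x z"
    and E_orbit: "\<And>x y. x \<in> D \<Longrightarrow> E x y \<Longrightarrow> \<exists>\<gamma>\<in>carrier \<Gamma>. y = \<phi> \<gamma> x"
    and E_finite: "\<And>x. x \<in> D \<Longrightarrow> finite {y. E x y}"
    and L: "countable L"
    and R_borel: "\<And>l l'. l \<in> L \<Longrightarrow> l' \<in> L \<Longrightarrow> orbit_borel (\<lambda>x y. R l x l' y)"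
    and solvable: "\<And>K. finite K \<Longrightarrow> K \<subseteq> D \<Longrightarrow>
      \<exists>c. \<forall>x\<in>K. c x \<in> L \<and> (\<forall>y\<in>K. R (c x) x (c y) y)"
  shows "\<exists>c. (\<forall>x\<in>D. c x \<in> L) \<and> (\<forall>l. {x\<in>D. c x = l} \<in> sets X) \<and>
    (\<forall>x\<in>D. \<forall>y. E x y \<longrightarrow> R (c x) x (c y) y)"
proof (cases "D = {}")
  case False
  have DX: "D \<subseteq> space X"
    using sets.sets_into_space[OF D] .
  define words where "words = lists (carrier \<Gamma> \<times> L)"
  have words: "countable words" "words \<noteq> {}"
    using countable_carrier L by (auto simp: words_def intro!: countable_lists exI[of _ "[]"])
  define word where "word = from_nat_into words"
  have word: "\<gamma> \<in> carrier \<Gamma>" "l \<in> L" if "(\<gamma>, l) \<in> set (word n)" for n \<gamma> l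
    using from_nat_into[OF words(2), of n] that by (auto simp: word_def words_def)
  \<comment> \<open>Quantifying over group elements instead of points keeps the condition Borel; by
    \<open>E_orbit\<close> it still ranges over the whole class.\<close>
  define root where "root r \<longleftrightarrow> r \<in> D \<and> (\<forall>\<gamma>\<in>carrier \<Gamma>. E r (\<phi> \<gamma> r) \<longrightarrow> \<not> lex_less (\<phi> \<gamma> r) r)" for r
  \<comment> \<open>The word names only points of the class, names all of them, and its labels
    satisfy the constraints. The last conjunct is needed because different group elements may move
    the root to the same point, the action not being assumed free.\<close>
  define good where "good r n \<longleftrightarrow>
      (\<forall>(\<gamma>, l)\<in>set (word n). E r (\<phi> \<gamma> r)) \<and>
      (\<forall>\<gamma>\<in>carrier \<Gamma>. E r (\<phi> \<gamma> r) \<longrightarrow> (\<exists>(\<delta>, l)\<in>set (word n). \<phi> \<delta> r = \<phi> \<gamma> r)) \<and>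
      (\<forall>(\<gamma>, l)\<in>set (word n). \<forall>(\<delta>, l')\<in>set (word n).
        R l (\<phi> \<gamma> r) l' (\<phi> \<delta> r) \<and> (\<phi> \<gamma> r = \<phi> \<delta> r \<longrightarrow> l = l'))" for r n
  define N where "N r = (LEAST n. good r n)" for r
  have pred_eq': "Measurable.pred X (\<lambda>x. \<phi> \<gamma> x = \<phi> \<delta> x)" if "\<gamma> \<in> carrier \<Gamma>" "\<delta> \<in> carrier \<Gamma>" for \<gamma> \<delta>
    using that by (intro pred_eq) auto
  have pred_lex': "Measurable.pred X (\<lambda>x. lex_less (\<phi> \<gamma> x) x)" if "\<gamma> \<in> carrier \<Gamma>" for \<gamma>
    using that by (intro pred_lex_less) auto
  have pred_D: "Measurable.pred X (\<lambda>x. x \<in> D)"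
    by measurable
  have pred_const: "Measurable.pred X (\<lambda>x. K)" for K
    by simp
  have [measurable]: "Measurable.pred X root"
    unfolding root_def
    by (intro pred_intros_logic(2-5) pred_countable_bounded countable_carrier
        orbit_borelD_one[OF E_borel] pred_lex' pred_D) auto
  have [measurable]: "Measurable.pred X (\<lambda>r. good r n)" for n
    unfolding good_def split_beta
    by (intro pred_intros_logic(2-5) pred_countable_bounded countable_carrier
        orbit_borelD_one[OF E_borel] pred_eq' orbit_borelD[OF R_borel] pred_const)
      (auto dest: word intro: countable_finite)
  \<comment> \<open>That \<open>n\<close> is the first good index is a finite Boolean combination of
    Borel conditions on the root.\<close>
  have root_N: "{r \<in> space X. root r \<and> good r n \<and> N r = n} \<in> sets X" for n
  proof -
    have "{r \<in> space X. root r \<and> good r n \<and> N r = n} =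
        {r \<in> space X. root r \<and> good r n \<and> (\<forall>k<n. \<not> good r k)}"
      unfolding N_def by (auto dest: not_less_Least intro!: Least_equality) (metis linorder_not_less)
    then show ?thesis
      by simp
  qed
  have ex_root: "\<exists>r. root r \<and> E r x" if x: "x \<in> D" for x
  proof -
    obtain r where r: "E x r" "\<And>y. E x y \<Longrightarrow> \<not> lex_less y r"
      using ex_lex_least[OF E_finite[OF x]] E_refl[OF x] by blast
    then have "r \<in> D"
      using E_D x by blast
    then have "root r"
      unfolding root_def using r E_trans[OF x] by blast
    then show ?thesis
      using E_sym[OF x r(1)] by blast
  qed
  have root_unique: "r = r'" if "root r" "E r x" "root r'" "E r' x" for r r' x
  proof (rule ccontr)
    assume ne: "r \<noteq> r'"
    have D': "r \<in> D" "r' \<in> D"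
      using that by (auto simp: root_def)
    have E': "E r r'" "E r' r"
      using that D' E_sym E_trans by metis+
    then have "\<not> lex_less r' r" "\<not> lex_less r r'"
      using E_orbit[OF D'(1) E'(1)] E_orbit[OF D'(2) E'(2)] that(1,3) unfolding root_def by metis+
    then show False
      using lex_less_total[of r r'] ne D' DX by blast
  qed
  have ex_good: "\<exists>n. good r n" if r: "r \<in> D" for r
  proof -
    define K where "K = {y. E r y}"
    have K: "finite K" "K \<subseteq> D"
      using E_finite[OF r] E_D[OF r] by (auto simp: K_def)
    then obtain c where c: "\<And>x. x \<in> K \<Longrightarrow> c x \<in> L" "\<And>x y. x \<in> K \<Longrightarrow> y \<in> K \<Longrightarrow> R (c x) x (c y) y"
      using solvable[OF K] by blast
    obtain g where g: "\<And>y. y \<in> K \<Longrightarrow> g y \<in> carrier \<Gamma>" "\<And>y. y \<in> K \<Longrightarrow> \<phi> (g y) r = y"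
      using bchoice[of K "\<lambda>y \<gamma>. \<gamma> \<in> carrier \<Gamma> \<and> \<phi> \<gamma> r = y"] E_orbit[OF r]
      unfolding K_def Bex_def by auto
    obtain ys where ys: "set ys = K"
      using finite_list[OF K(1)] by blast
    define xs where "xs = map (\<lambda>y. (g y, c y)) ys"
    have "xs \<in> words"
      using ys c(1) g(1) by (auto simp: xs_def words_def)
    then obtain n where n: "word n = xs"
      unfolding word_def using from_nat_into_surj[OF words(1)] by blast
    have set_xs: "set xs = (\<lambda>y. (g y, c y)) ` K"
      using ys by (simp add: xs_def)
    have "good r n"
      unfolding good_def n set_xs using g c by (auto simp: K_def)
    then show ?thesis ..
  qed
  have good_N: "good r (N r)" if "root r" for r
    unfolding N_def using ex_good[of r] that LeastI_ex by (auto simp: root_def)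
  define lab where "lab x l \<longleftrightarrow> (\<exists>r \<gamma>. root r \<and> E r x \<and> (\<gamma>, l) \<in> set (word (N r)) \<and> \<phi> \<gamma> r = x)" for x l
  have ex_lab: "\<exists>l. lab x l" if x: "x \<in> D" for x
  proof -
    obtain r where r: "root r" "E r x"
      using ex_root[OF x] by blast
    moreover obtain \<gamma> where "\<gamma> \<in> carrier \<Gamma>" "x = \<phi> \<gamma> r"
      using E_orbit[OF _ r(2)] r(1) by (auto simp: root_def)
    ultimately show ?thesis
      using good_N[OF r(1)] unfolding good_def lab_def by fast
  qed
  have lab_unique: "l = l'" if "lab x l" "lab x l'" for x l l'
  proof -
    obtain r \<gamma> r' \<gamma>' where r: "root r" "E r x" "(\<gamma>, l) \<in> set (word (N r))" "\<phi> \<gamma> r = x"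
      "root r'" "E r' x" "(\<gamma>', l') \<in> set (word (N r'))" "\<phi> \<gamma>' r' = x"
      using \<open>lab x l\<close> \<open>lab x l'\<close> unfolding lab_def by blast
    then have "r' = r"
      using root_unique by blast
    with r good_N[OF r(1)] show ?thesis
      unfolding good_def by blast
  qed
  define c where "c x = (THE l. lab x l)" for x
  have c: "lab x (c x)" if "x \<in> D" for x
    unfolding c_def using ex_lab[OF that] lab_unique by (metis theI)
  show ?thesis
  proof (intro exI[of _ c] conjI ballI allI impI)
    fix x assume "x \<in> D"
    then show "c x \<in> L"
      using c unfolding lab_def by (metis word(2))
  next
    fix l
    \<comment> \<open>A point receives label \<open>l\<close> exactly if it is the translate of its
      root named with \<open>l\<close>, so the label class is a countable union of translates of
      Borel sets of roots.\<close>
    have "{x\<in>D. c x = l} = (\<Union>n. \<Union>(\<gamma>, l')\<in>{p\<in>set (word n). snd p = l}.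
        \<phi> \<gamma> ` {r \<in> space X. root r \<and> good r n \<and> N r = n})" (is "?A = ?B")
    proof (intro equalityI subsetI)
      fix x assume "x \<in> ?A"
      then obtain r \<gamma> where r: "root r" "(\<gamma>, l) \<in> set (word (N r))" "\<phi> \<gamma> r = x"
        using c unfolding lab_def by blast
      then have "r \<in> {r' \<in> space X. root r' \<and> good r' (N r) \<and> N r' = N r}"
        using good_N DX by (auto simp: root_def)
      then show "x \<in> ?B"
        using r by force
    next
      fix x assume "x \<in> ?B"
      then obtain \<gamma> r where r: "(\<gamma>, l) \<in> set (word (N r))" "root r" "good r (N r)" "x = \<phi> \<gamma> r"
        by auto
      then have "E r x"
        unfolding good_def by fast
      moreover have "x \<in> D"
        using \<open>E r x\<close> r(2) E_D by (auto simp: root_def)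
      ultimately show "x \<in> ?A"
        using r lab_unique[OF c] unfolding lab_def by blast
    qed
    also have "\<dots> \<in> sets X"
      by (intro sets.countable_UN'' sets.finite_UN countableI_type)
        (auto dest: word intro!: act_image_sets root_N)
    finally show "?A \<in> sets X" .
  next
    fix x y assume x: "x \<in> D" and xy: "E x y"
    then have y: "y \<in> D"
      using E_D by blast
    obtain r \<gamma> where r: "root r" "E r x" "(\<gamma>, c x) \<in> set (word (N r))" "\<phi> \<gamma> r = x"
      using c[OF x] unfolding lab_def by blast
    obtain r' \<gamma>' where r': "root r'" "E r' y" "(\<gamma>', c y) \<in> set (word (N r'))" "\<phi> \<gamma>' r' = y"
      using c[OF y] unfolding lab_def by blast
    have "E r y"
      using E_trans[OF _ r(2) xy] r(1) by (auto simp: root_def)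
    then have "r' = r"
      using root_unique r r' by blast
    have "\<forall>p\<in>set (word (N r)). \<forall>q\<in>set (word (N r)). R (snd p) (\<phi> (fst p) r) (snd q) (\<phi> (fst q) r)"
      using good_N[OF r(1)] unfolding good_def split_beta by blast
    from bspec[OF bspec[OF this r(3)] r'(3)[unfolded \<open>r' = r\<close>]] show "R (c x) x (c y) y"
      using r(4) r'(4) \<open>r' = r\<close> by simp
  qed
qed auto

end

section \<open>Expansion of paradoxical sets\<close>

context group_action
begin

interpretation group G
  using group_hom group_hom.axioms(1) by auto

section \<open>Counting translates of finite sets\<close>

definition translates where
  "translates F S = (\<Union>\<gamma>\<in>F. \<phi> \<gamma> ` S)"

lemma finite_translates: "finite F \<Longrightarrow> finite S \<Longrightarrow> finite (translates F S)"
  by (simp add: translates_def)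

lemma translates_mono: "S \<subseteq> S' \<Longrightarrow> translates F S \<subseteq> translates F S'"
  by (auto simp: translates_def)

lemma card_translates_mono:
  assumes "finite F" "finite S'" "S \<subseteq> S'"
  shows "card (translates F S \<inter> A) \<le> card (translates F S' \<inter> A)"
  using finite_translates[OF assms(1,2)] translates_mono[OF assms(3), of F]
  by (intro card_mono) auto

lemma card_translates_le: "finite F \<Longrightarrow> finite S \<Longrightarrow> card (translates F S) \<le> card F * card S"
proof -
  assume "finite F" "finite S"
  then have "card (translates F S) \<le> (\<Sum>\<gamma>\<in>F. card (\<phi> \<gamma> ` S))"
    unfolding translates_def by (intro card_UN_le)
  also have "\<dots> \<le> (\<Sum>\<gamma>\<in>F. card S)"
    using \<open>finite S\<close> by (intro sum_mono card_image_le)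
  finally show ?thesis
    by simp
qed

lemma finite_set_mult: "finite H \<Longrightarrow> finite K \<Longrightarrow> finite (H <#> K)"
  by (simp add: set_mult_def)

lemma set_mult_carrier: "H \<subseteq> carrier G \<Longrightarrow> K \<subseteq> carrier G \<Longrightarrow> H <#> K \<subseteq> carrier G"
  by (auto simp: set_mult_def)

lemma translates_set_mult:
  assumes "H \<subseteq> carrier G" "K \<subseteq> carrier G" "S \<subseteq> E"
  shows "translates (H <#> K) S = translates H (translates K S)"
proof -
  have "\<phi> (h \<otimes> k) ` S = \<phi> h ` \<phi> k ` S" if "h \<in> H" "k \<in> K" for h k
    unfolding image_image using assms that
    by (intro image_cong refl composition_rule) auto
  then show ?thesis
    by (auto simp: translates_def set_mult_def image_UN)
qed

definition piecewise_translation_on where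
  "piecewise_translation_on F D f \<longleftrightarrow> (\<forall>x\<in>D. \<exists>\<gamma>\<in>F. f x = \<phi> \<gamma> x)"

section \<open>Equidecompositions as piecewise translations\<close>

text \<open>Let the map act on each \<open>P i\<close> by its group element. Disjointness of the
  sets \<open>Q i\<close> gives injectivity between pieces, invertibility of the group elements
  gives it within a piece.\<close>

lemma equidecomposable_imp_piecewise_translation:
  assumes "equidecomposable G \<phi> A B" "A \<subseteq> E"
  shows "\<exists>F f. finite F \<and> F \<subseteq> carrier G \<and> piecewise_translation_on F A f \<and> bij_betw f A B"
proof -
  obtain k P Q where PQ: "indexed_partition k P A" "indexed_partition k Q B"
    "\<And>i. i < k \<Longrightarrow> \<exists>\<gamma>\<in>carrier G. Q i = \<phi> \<gamma> ` P i"
    using assms(1) unfolding equidecomposable_def equidecomposition_def by blast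
  obtain g where g: "\<And>i. i < k \<Longrightarrow> g i \<in> carrier G" "\<And>i. i < k \<Longrightarrow> Q i = \<phi> (g i) ` P i"
    using PQ(3) by metis
  have "\<forall>x\<in>A. \<exists>i<k. x \<in> P i"
    using PQ(1) by (auto simp: indexed_partition_def)
  then obtain j where j: "\<And>x. x \<in> A \<Longrightarrow> j x < k" "\<And>x. x \<in> A \<Longrightarrow> x \<in> P (j x)"
    by metis
  have j_eq: "j x = i" if "x \<in> P i" "i < k" for x i
  proof -
    have "x \<in> A"
      using that PQ(1) by (auto simp: indexed_partition_def)
    then show ?thesis
      using that j[of x] PQ(1) unfolding indexed_partition_def disjoint_family_on_def
      by (metis disjoint_iff lessThan_iff)
  qed
  have PA: "P i \<subseteq> A" if "i < k" for i
    using that PQ(1) by (auto simp: indexed_partition_def)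
  define f where "f x = \<phi> (g (j x)) x" for x
  have fQ: "f x \<in> Q (j x)" if "x \<in> A" for x
    using j[OF that] g(2) by (simp add: f_def)
  have "inj_on f A"
  proof (rule inj_onI)
    fix x y assume xy: "x \<in> A" "y \<in> A" "f x = f y"
    then have "j x = j y"
      using fQ[OF xy(1)] fQ[OF xy(2)] j(1) PQ(2)
      unfolding indexed_partition_def disjoint_family_on_def by (metis disjoint_iff lessThan_iff)
    then show "x = y"
      using xy j(1) g(1) inj_prop[of "g (j x)"] assms(2) unfolding f_def inj_on_def by (metis subsetD)
  qed
  moreover have "f ` A = B"
  proof
    show "f ` A \<subseteq> B"
      using fQ j(1) PQ(2) by (auto simp: indexed_partition_def)
    show "B \<subseteq> f ` A"
    proof
      fix y assume "y \<in> B"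
      then obtain i where i: "i < k" "y \<in> Q i"
        using PQ(2) by (auto simp: indexed_partition_def)
      then obtain x where "x \<in> P i" "y = \<phi> (g i) x"
        using g(2) by blast
      then show "y \<in> f ` A"
        using j_eq[of x i] i PA by (auto simp: f_def)
    qed
  qed
  moreover have "piecewise_translation_on (g ` {..<k}) A f"
    using j(1) by (auto simp: piecewise_translation_on_def f_def)
  moreover have "g ` {..<k} \<subseteq> carrier G"
    using g(1) by auto
  ultimately show ?thesis
    unfolding bij_betw_def by blast
qed

text \<open>The inverses of the finitely many moves carry the image of each point of
  \<open>A\<close> back to that point.\<close>

lemma equidecomposable_imp_covered:
  assumes "equidecomposable G \<phi> A B" "A \<subseteq> E"
  shows "\<exists>F. finite F \<and> F \<subseteq> carrier G \<and> A \<subseteq> (\<Union>\<gamma>\<in>F. \<phi> \<gamma> ` B)"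
proof -
  obtain F f where F: "finite F" "F \<subseteq> carrier G" "piecewise_translation_on F A f" "bij_betw f A B"
    using equidecomposable_imp_piecewise_translation[OF assms] by blast
  have "A \<subseteq> (\<Union>\<gamma>\<in>m_inv G ` F. \<phi> \<gamma> ` B)"
  proof
    fix x assume "x \<in> A"
    then obtain \<gamma> where \<gamma>: "\<gamma> \<in> F" "f x = \<phi> \<gamma> x"
      using F(3) unfolding piecewise_translation_on_def by blast
    then have "x = \<phi> (inv \<gamma>) (f x)"
      using orbit_sym_aux[OF _ _ refl, of \<gamma> x] F(2) \<open>x \<in> A\<close> assms(2) by (metis subsetD)
    moreover have "f x \<in> B"
      using F(4) \<open>x \<in> A\<close> by (auto simp: bij_betw_def)
    ultimately show "x \<in> (\<Union>\<gamma>\<in>m_inv G ` F. \<phi> \<gamma> ` B)"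
      using \<gamma>(1) by blast
  qed
  moreover have "finite (m_inv G ` F)" "m_inv G ` F \<subseteq> carrier G"
    using F(1,2) by auto
  ultimately show ?thesis
    by blast
qed

lemma equidecomposable_imp_covered_rev:
  assumes "equidecomposable G \<phi> A B"
  shows "\<exists>F. finite F \<and> F \<subseteq> carrier G \<and> B \<subseteq> (\<Union>\<gamma>\<in>F. \<phi> \<gamma> ` A)"
proof -
  obtain k P Q where "equidecomposition G \<phi> k P Q A B"
    using assms by (auto simp: equidecomposable_def)
  then have PQ: "(\<Union>i<k. P i) = A" "(\<Union>i<k. Q i) = B"
    "\<And>i. i < k \<Longrightarrow> \<exists>\<gamma>\<in>carrier G. Q i = \<phi> \<gamma> ` P i"
    by (auto simp: equidecomposition_def indexed_partition_def)
  obtain g where g: "\<And>i. i < k \<Longrightarrow> g i \<in> carrier G" "\<And>i. i < k \<Longrightarrow> Q i = \<phi> (g i) ` P i"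
    using PQ(3) by metis
  have "B \<subseteq> (\<Union>\<gamma>\<in>g ` {..<k}. \<phi> \<gamma> ` A)"
  proof
    fix y assume "y \<in> B"
    then obtain i where i: "i < k" "y \<in> Q i"
      using PQ(2) by blast
    then obtain x where "x \<in> P i" "y = \<phi> (g i) x"
      using g(2) by blast
    then show "y \<in> (\<Union>\<gamma>\<in>g ` {..<k}. \<phi> \<gamma> ` A)"
      using PQ(1) i(1) by auto
  qed
  moreover have "finite (g ` {..<k})" "g ` {..<k} \<subseteq> carrier G"
    using g(1) by auto
  ultimately show ?thesis
    by blast
qed

section \<open>Growth factors from paradoxicality\<close>

text \<open>The two injections of \<open>A\<close> into disjoint parts of \<open>A\<close> give
  every finite \<open>S\<close> two disjoint copies inside \<open>A\<close>. Iterating this doubling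
  \<open>n\<close> times multiplies the sets of moves and gives the factor
  \<open>2 ^ n\<close>.\<close>

lemma paradoxical_expansion:
  assumes "paradoxical G \<phi> A" "A \<subseteq> E"
  shows "\<exists>F. finite F \<and> F \<subseteq> carrier G \<and>
    (\<forall>S. finite S \<longrightarrow> S \<subseteq> A \<longrightarrow> 2 ^ n * card S \<le> card (translates F S \<inter> A))"
proof -
  obtain A0 A1 where A: "A0 \<union> A1 = A" "A0 \<inter> A1 = {}"
    "equidecomposable G \<phi> A A0" "equidecomposable G \<phi> A A1"
    using assms(1) unfolding paradoxical_def by blast
  obtain F0 f0 where f0: "finite F0" "F0 \<subseteq> carrier G" "piecewise_translation_on F0 A f0" "bij_betw f0 A A0"
    using equidecomposable_imp_piecewise_translation[OF A(3) assms(2)] by blast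
  obtain F1 f1 where f1: "finite F1" "F1 \<subseteq> carrier G" "piecewise_translation_on F1 A f1" "bij_betw f1 A A1"
    using equidecomposable_imp_piecewise_translation[OF A(4) assms(2)] by blast
  define F where "F = F0 \<union> F1"
  have F: "finite F" "F \<subseteq> carrier G"
    using f0 f1 by (auto simp: F_def)
  have double: "2 * card S \<le> card (translates F S \<inter> A)" if S: "finite S" "S \<subseteq> A" for S
  proof -
    have "f0 ` S \<subseteq> A0" "f1 ` S \<subseteq> A1"
      using f0(4) f1(4) S(2) by (auto simp: bij_betw_def)
    then have "2 * card S = card (f0 ` S) + card (f1 ` S)"
      using f0(4) f1(4) S(2) by (metis bij_betw_def card_image inj_on_subset mult_2)
    also have "\<dots> = card (f0 ` S \<union> f1 ` S)"
      using \<open>f0 ` S \<subseteq> A0\<close> \<open>f1 ` S \<subseteq> A1\<close> S(1) A(2) by (intro card_Un_disjoint[symmetric]) auto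
    finally have "2 * card S = card (f0 ` S \<union> f1 ` S)" .
    moreover have "f0 ` S \<union> f1 ` S \<subseteq> translates F S \<inter> A"
    proof -
      have "f0 ` S \<union> f1 ` S \<subseteq> translates F S"
        using f0(3) f1(3) S(2) unfolding piecewise_translation_on_def translates_def F_def by fastforce
      then show ?thesis
        using \<open>f0 ` S \<subseteq> A0\<close> \<open>f1 ` S \<subseteq> A1\<close> A(1) by blast
    qed
    then have "card (f0 ` S \<union> f1 ` S) \<le> card (translates F S \<inter> A)"
      using finite_translates[OF F(1) S(1)] by (intro card_mono) auto
    ultimately show ?thesis
      by simp
  qed
  show ?thesis
  proof (induction n)
    case 0
    have "S \<subseteq> translates {\<one>} S \<inter> A" if "S \<subseteq> A" for S
      using that assms(2) by (auto simp: translates_def image_iff id_eq_one[symmetric])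
    then have "card S \<le> card (translates {\<one>} S \<inter> A)" if "finite S" "S \<subseteq> A" for S
      using that finite_translates[of "{\<one>}" S] by (intro card_mono) auto
    then show ?case
      by (intro exI[of _ "{\<one>}"]) auto
  next
    case (Suc n)
    then obtain H where H: "finite H" "H \<subseteq> carrier G"
      "\<And>S. finite S \<Longrightarrow> S \<subseteq> A \<Longrightarrow> 2 ^ n * card S \<le> card (translates H S \<inter> A)"
      by blast
    have "2 ^ Suc n * card S \<le> card (translates (F <#> H) S \<inter> A)" if S: "finite S" "S \<subseteq> A" for S
    proof -
      have "2 ^ Suc n * card S \<le> 2 * card (translates H S \<inter> A)"
        using H(3)[OF S] by simp
      also have "\<dots> \<le> card (translates F (translates H S \<inter> A) \<inter> A)"
        using finite_translates[OF H(1) S(1)] by (intro double) auto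
      also have "\<dots> \<le> card (translates F (translates H S) \<inter> A)"
        using finite_translates[OF H(1) S(1)] by (intro card_translates_mono F(1)) auto
      also have "translates F (translates H S) = translates (F <#> H) S"
        using translates_set_mult[OF F(2) H(2)] S(2) assms(2) by auto
      finally show ?thesis .
    qed
    then show ?case
      using finite_set_mult[OF F(1) H(1)] set_mult_carrier[OF F(2) H(2)] by blast
  qed
qed

text \<open>Each point of \<open>S\<close> is a translate by \<open>H\<close> of some point of
  \<open>B\<close>, which in turn is reached from \<open>S\<close> by an inverse; one such point of
  \<open>B\<close> serves at most \<open>card H\<close> points of \<open>S\<close>.\<close>

lemma covered_expansion:
  assumes "A \<subseteq> E" "B \<subseteq> E" and H: "finite H" "H \<subseteq> carrier G" "A \<subseteq> (\<Union>\<gamma>\<in>H. \<phi> \<gamma> ` B)"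
    and S: "finite S" "S \<subseteq> A"
  shows "card S \<le> card H * card (translates (m_inv G ` H) S \<inter> B)"
proof -
  have fin: "finite (translates (m_inv G ` H) S)"
    using finite_translates H(1) S(1) by blast
  have "S \<subseteq> translates H (translates (m_inv G ` H) S \<inter> B)"
  proof
    fix x assume "x \<in> S"
    then obtain \<gamma> b where \<gamma>: "\<gamma> \<in> H" "b \<in> B" "x = \<phi> \<gamma> b"
      using S(2) H(3) by blast
    then have "b = \<phi> (inv \<gamma>) x"
      using orbit_sym_aux[OF _ _ refl, of \<gamma> b] H(2) assms(2) by (metis subsetD)
    then have "b \<in> translates (m_inv G ` H) S"
      using \<gamma>(1) \<open>x \<in> S\<close> by (auto simp: translates_def)
    then show "x \<in> translates H (translates (m_inv G ` H) S \<inter> B)"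
      using \<gamma> by (auto simp: translates_def)
  qed
  then have "card S \<le> card (translates H (translates (m_inv G ` H) S \<inter> B))"
    using finite_translates[OF H(1)] fin by (intro card_mono) auto
  also have "\<dots> \<le> card H * card (translates (m_inv G ` H) S \<inter> B)"
    using card_translates_le[OF H(1)] fin by simp
  finally show ?thesis .
qed

text \<open>If \<open>A\<close> is paradoxical, expand inside \<open>A\<close> and then pass to
  \<open>B\<close>; if \<open>B\<close> is, pass to \<open>B\<close> and then expand there. Either
  way the passage costs only the fixed factor \<open>card H\<close>.\<close>

lemma paradoxical_covered_expansion:
  assumes AB: "A \<subseteq> E" "B \<subseteq> E" and para: "paradoxical G \<phi> A \<or> paradoxical G \<phi> B"
    and H: "finite H" "H \<subseteq> carrier G" "A \<subseteq> (\<Union>\<gamma>\<in>H. \<phi> \<gamma> ` B)"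
  shows "\<exists>F. finite F \<and> F \<subseteq> carrier G \<and>
    (\<forall>S. finite S \<longrightarrow> S \<subseteq> A \<longrightarrow> N * card S \<le> card (translates F S \<inter> B))"
proof -
  define H' where "H' = m_inv G ` H"
  have H': "finite H'" "H' \<subseteq> carrier G"
    using H(1,2) by (auto simp: H'_def)
  note cov = covered_expansion[OF AB H, folded H'_def]
  \<comment> \<open>Enough doublings to pay for the factor \<open>card H\<close> and still leave
    \<open>N\<close>.\<close>
  obtain n where n: "N * card H \<le> 2 ^ n"
    using that[OF less_imp_le[OF less_exp]] .
  have "\<exists>F. finite F \<and> F \<subseteq> carrier G \<and>
    (\<forall>S. finite S \<longrightarrow> S \<subseteq> A \<longrightarrow> 2 ^ n * card S \<le> card H * card (translates F S \<inter> B))"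
    using para
  proof
    assume "paradoxical G \<phi> A"
    then obtain F where F: "finite F" "F \<subseteq> carrier G"
      "\<And>S. finite S \<Longrightarrow> S \<subseteq> A \<Longrightarrow> 2 ^ n * card S \<le> card (translates F S \<inter> A)"
      using paradoxical_expansion[OF \<open>paradoxical G \<phi> A\<close> AB(1), of n] by blast
    have "2 ^ n * card S \<le> card H * card (translates (H' <#> F) S \<inter> B)" if S: "finite S" "S \<subseteq> A" for S
    proof -
      have fin: "finite (translates F S)"
        using finite_translates F(1) S(1) by blast
      have "2 ^ n * card S \<le> card (translates F S \<inter> A)"
        using F(3) S by blast
      also have "\<dots> \<le> card H * card (translates H' (translates F S \<inter> A) \<inter> B)"
        using fin by (intro cov) auto
      also have "\<dots> \<le> card H * card (translates H' (translates F S) \<inter> B)"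
        using fin by (intro mult_le_mono2 card_translates_mono H'(1)) auto
      also have "translates H' (translates F S) = translates (H' <#> F) S"
        using translates_set_mult[OF H'(2) F(2)] S(2) AB(1) by auto
      finally show ?thesis .
    qed
    then show ?thesis
      using finite_set_mult[OF H'(1) F(1)] set_mult_carrier[OF H'(2) F(2)] by blast
  next
    assume "paradoxical G \<phi> B"
    then obtain F where F: "finite F" "F \<subseteq> carrier G"
      "\<And>S. finite S \<Longrightarrow> S \<subseteq> B \<Longrightarrow> 2 ^ n * card S \<le> card (translates F S \<inter> B)"
      using paradoxical_expansion[OF \<open>paradoxical G \<phi> B\<close> AB(2), of n] by blast
    have "2 ^ n * card S \<le> card H * card (translates (F <#> H') S \<inter> B)" if S: "finite S" "S \<subseteq> A" for S
    proof -
      have fin: "finite (translates H' S)"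
        using finite_translates H'(1) S(1) by blast
      have "2 ^ n * card S \<le> 2 ^ n * (card H * card (translates H' S \<inter> B))"
        using cov[OF S] by simp
      also have "\<dots> = card H * (2 ^ n * card (translates H' S \<inter> B))"
        by simp
      also have "\<dots> \<le> card H * card (translates F (translates H' S \<inter> B) \<inter> B)"
        using fin by (intro mult_le_mono2 F(3)) auto
      also have "\<dots> \<le> card H * card (translates F (translates H' S) \<inter> B)"
        using fin by (intro mult_le_mono2 card_translates_mono F(1)) auto
      also have "translates F (translates H' S) = translates (F <#> H') S"
        using translates_set_mult[OF F(2) H'(2)] S(2) AB(1) by auto
      finally show ?thesis .
    qed
    then show ?thesis
      using finite_set_mult[OF F(1) H'(1)] set_mult_carrier[OF F(2) H'(2)] by blast
  qed
  then obtain F where F: "finite F" "F \<subseteq> carrier G"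
    "\<And>S. finite S \<Longrightarrow> S \<subseteq> A \<Longrightarrow> 2 ^ n * card S \<le> card H * card (translates F S \<inter> B)"
    by blast
  have "N * card S \<le> card (translates F S \<inter> B)" if S: "finite S" "S \<subseteq> A" for S
  proof (cases "card H = 0")
    case True
    \<comment> \<open>The factor \<open>card H\<close> cannot be cancelled here, but an empty
      \<open>H\<close> covers only the empty set.\<close>
    then have "A = {}"
      using H by auto
    then show ?thesis
      using S by simp
  next
    case False
    have "card H * (N * card S) \<le> 2 ^ n * card S"
      using mult_le_mono1[OF n, of "card S"] by (simp add: ac_simps)
    also have "\<dots> \<le> card H * card (translates F S \<inter> B)"
      by (rule F(3)[OF S])
    finally show ?thesis
      using False by simp
  qed
  then show ?thesis
    using F(1,2) by blast
qed

end

section \<open>Borel piecewise translations\<close>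

context separated_borel_action
begin

text \<open>The values of \<open>f\<close> off \<open>D\<close> are arbitrary, so measurability is
  stated by preimages relative to \<open>D\<close>. No partition is recorded:
  \<open>bpt_eq_translate_sets\<close> recovers Borel pieces from \<open>f\<close> itself.\<close>

definition borel_piecewise_translation :: "'g set \<Rightarrow> 'x set \<Rightarrow> ('x \<Rightarrow> 'x) \<Rightarrow> bool" where
  "borel_piecewise_translation F D f \<longleftrightarrow>
     finite F \<and> F \<subseteq> carrier \<Gamma> \<and> D \<in> sets X \<and> piecewise_translation_on F D f \<and>
     (\<forall>C\<in>sets X. {x \<in> D. f x \<in> C} \<in> sets X)"

lemma bptD:
  assumes "borel_piecewise_translation F D f"
  shows "finite F" "F \<subseteq> carrier \<Gamma>" "D \<in> sets X" "piecewise_translation_on F D f" "D \<subseteq> space X"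
    "\<And>x. x \<in> D \<Longrightarrow> f x \<in> space X" "\<And>C. C \<in> sets X \<Longrightarrow> {x \<in> D. f x \<in> C} \<in> sets X"
proof -
  show *: "finite F" "F \<subseteq> carrier \<Gamma>" "D \<in> sets X" "piecewise_translation_on F D f"
    "\<And>C. C \<in> sets X \<Longrightarrow> {x \<in> D. f x \<in> C} \<in> sets X"
    using assms by (auto simp: borel_piecewise_translation_def)
  show D: "D \<subseteq> space X"
    using sets.sets_into_space *(3) by blast
  show "f x \<in> space X" if "x \<in> D" for x
    using * D that act_closed unfolding piecewise_translation_on_def by (metis subsetD)
qed

text \<open>Two points differ exactly if some \<open>V n\<close> contains just one of them, so the
  exceptional set is a countable union of Borel sets.\<close>

lemma bpt_eq_translate_sets:
  assumes "borel_piecewise_translation F D f" "\<gamma> \<in> carrier \<Gamma>"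
  shows "{x \<in> D. f x = \<phi> \<gamma> x} \<in> sets X"
proof -
  note f = bptD[OF assms(1)]
  have "{x \<in> D. f x = \<phi> \<gamma> x} =
      D - (\<Union>n. {x \<in> D. f x \<in> V n \<longleftrightarrow> \<phi> \<gamma> x \<notin> V n})"
  proof -
    have "f x = \<phi> \<gamma> x \<longleftrightarrow> (\<forall>n. f x \<in> V n \<longleftrightarrow> \<phi> \<gamma> x \<in> V n)" if "x \<in> D" for x
      using V_separates[OF f(6)[OF that] act_closed[OF assms(2) subsetD[OF f(5) that]]] by auto
    then show ?thesis
      by auto
  qed
  also have "\<dots> \<in> sets X"
  proof (intro sets.Diff f(3) sets.countable_UN image_subsetI)
    fix n
    let ?P = "{x \<in> D. f x \<in> V n}" and ?Q = "\<phi> \<gamma> -` V n \<inter> space X"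
    have "{x \<in> D. f x \<in> V n \<longleftrightarrow> \<phi> \<gamma> x \<notin> V n} = (?P - ?Q) \<union> (D \<inter> ?Q - ?P)"
      using f(5) by blast
    then show "{x \<in> D. f x \<in> V n \<longleftrightarrow> \<phi> \<gamma> x \<notin> V n} \<in> sets X"
      using f(3) f(7)[OF V_sets] measurable_sets[OF act_measurable[OF assms(2)] V_sets] by simp
  qed
  finally show ?thesis .
qed

text \<open>Images of Borel sets under Borel maps need not be Borel. Here \<open>C\<close> splits
  into finitely many Borel parts on which \<open>f\<close> is a group element, and translates of
  Borel sets are Borel.\<close>

lemma bpt_image_sets:
  assumes "borel_piecewise_translation F D f" "C \<in> sets X" "C \<subseteq> D"
  shows "f ` C \<in> sets X"
proof -
  note f = bptD[OF assms(1)]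
  have "f ` C = (\<Union>\<gamma>\<in>F. \<phi> \<gamma> ` (C \<inter> {x \<in> D. f x = \<phi> \<gamma> x}))"
  proof (intro equalityI subsetI)
    fix y assume "y \<in> f ` C"
    then obtain x where x: "x \<in> C" "x \<in> D" "y = f x"
      using assms(3) by blast
    then obtain \<gamma> where "\<gamma> \<in> F" "f x = \<phi> \<gamma> x"
      using f(4) unfolding piecewise_translation_on_def by blast
    then show "y \<in> (\<Union>\<gamma>\<in>F. \<phi> \<gamma> ` (C \<inter> {x \<in> D. f x = \<phi> \<gamma> x}))"
      using x by (intro UN_I[of \<gamma>] image_eqI[of _ _ x]) auto
  next
    fix y assume "y \<in> (\<Union>\<gamma>\<in>F. \<phi> \<gamma> ` (C \<inter> {x \<in> D. f x = \<phi> \<gamma> x}))"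
    then obtain \<gamma> x where "x \<in> C" "f x = \<phi> \<gamma> x" "y = \<phi> \<gamma> x"
      by blast
    then show "y \<in> f ` C"
      by (intro image_eqI[of _ _ x]) auto
  qed
  also have "\<dots> \<in> sets X"
    using f(1,2) assms(2) bpt_eq_translate_sets[OF assms(1)]
    by (intro sets.finite_UN act_image_sets sets.Int) auto
  finally show ?thesis .
qed

lemma bpt_subset:
  assumes "borel_piecewise_translation F D f" "C \<in> sets X" "C \<subseteq> D"
  shows "borel_piecewise_translation F C f"
proof -
  have "{x \<in> C. f x \<in> C'} = C \<inter> {x \<in> D. f x \<in> C'}" for C'
    using assms(3) by auto
  then show ?thesis
    using assms by (auto simp: borel_piecewise_translation_def piecewise_translation_on_def)
qed

lemma bpt_If:
  assumes "borel_piecewise_translation F D f" "borel_piecewise_translation F' D' g"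
  shows "borel_piecewise_translation (F \<union> F') (D \<union> D') (\<lambda>x. if x \<in> D then f x else g x)"
proof -
  note f = bptD[OF assms(1)] and g = bptD[OF assms(2)]
  have "{x \<in> D \<union> D'. (if x \<in> D then f x else g x) \<in> C} = {x \<in> D. f x \<in> C} \<union> ({x \<in> D'. g x \<in> C} - D)" for C
    by auto
  then show ?thesis
    using f(1-4,7) g(1-4,7) unfolding borel_piecewise_translation_def piecewise_translation_on_def
    by (auto simp: Bex_def)
qed

text \<open>Preimages under the inverse are images under \<open>f\<close>, and the inverse moves
  each point by the inverse of a group element in \<open>F\<close>.\<close>

lemma bpt_inv_into:
  assumes "borel_piecewise_translation F D f" "inj_on f D"
  shows "borel_piecewise_translation (m_inv \<Gamma> ` F) (f ` D) (inv_into D f)"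
proof -
  note f = bptD[OF assms(1)]
  have "{y \<in> f ` D. inv_into D f y \<in> C} = f ` (D \<inter> C)" for C
    using assms(2) by auto
  then have "{y \<in> f ` D. inv_into D f y \<in> C} \<in> sets X" if "C \<in> sets X" for C
    using that f(3) bpt_image_sets[OF assms(1)] by auto
  moreover have "\<exists>\<gamma>\<in>F. inv_into D f (f x) = \<phi> (inv \<gamma>) (f x)" if x: "x \<in> D" for x
  proof -
    obtain \<gamma> where \<gamma>: "\<gamma> \<in> F" "f x = \<phi> \<gamma> x"
      using f(4) x unfolding piecewise_translation_on_def by blast
    then have "\<phi> (inv \<gamma>) (f x) = x"
      using act_inv_act[OF subsetD[OF f(2) \<gamma>(1)] subsetD[OF f(5) x]] by simp
    then show ?thesis
      using \<gamma>(1) inv_into_f_f[OF assms(2) x] by metis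
  qed
  ultimately show ?thesis
    using f(1,2) bpt_image_sets[OF assms(1) f(3)]
    unfolding borel_piecewise_translation_def piecewise_translation_on_def by auto
qed

lemma bpt_imp_borel_equidecomposable:
  assumes "borel_piecewise_translation F D f" "inj_on f D"
  shows "borel_equidecomposable \<Gamma> X \<phi> D (f ` D)"
proof -
  note f = bptD[OF assms(1)]
  obtain gs where gs: "set gs = F"
    using finite_list[OF f(1)] by blast
  define k where "k = length gs"
  have g: "gs ! i \<in> carrier \<Gamma>" if "i < k" for i
    using that gs f(2) by (auto simp: k_def)
  \<comment> \<open>Several elements may move a point in the same way; the first one in the list
    decides, which makes the pieces disjoint.\<close>
  define P where "P i = {x \<in> D. f x = \<phi> (gs ! i) x} - (\<Union>j<i. {x \<in> D. f x = \<phi> (gs ! j) x})" for i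
  have P_sets: "P i \<in> sets X" if "i < k" for i
    unfolding P_def using that by (intro sets.Diff sets.finite_UN bpt_eq_translate_sets[OF assms(1)] g) auto
  have PD: "P i \<subseteq> D" for i
    by (auto simp: P_def)
  have disj: "P i \<inter> P j = {}" if "i \<noteq> j" for i j
    using that by (cases i j rule: linorder_cases) (auto simp: P_def)
  have cover: "\<exists>i<k. x \<in> P i" if x: "x \<in> D" for x
  proof -
    define i where "i = (LEAST i. f x = \<phi> (gs ! i) x)"
    obtain \<gamma> where \<gamma>: "\<gamma> \<in> set gs" "f x = \<phi> \<gamma> x"
      using f(4) x unfolding piecewise_translation_on_def gs by blast
    then obtain j where j: "j < k" "f x = \<phi> (gs ! j) x"
      unfolding k_def by (metis in_set_conv_nth)
    have "f x = \<phi> (gs ! i) x"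
      unfolding i_def using j(2) by (rule LeastI)
    moreover have "i \<le> j"
      unfolding i_def using j(2) by (rule Least_le)
    moreover have "f x \<noteq> \<phi> (gs ! l) x" if "l < i" for l
      using that unfolding i_def by (rule not_less_Least)
    ultimately show ?thesis
      using x j(1) by (intro exI[of _ i]) (auto simp: P_def)
  qed
  have "equidecomposition \<Gamma> \<phi> k P (\<lambda>i. f ` P i) D (f ` D)"
    unfolding equidecomposition_def indexed_partition_def
  proof (intro conjI allI impI)
    show "disjoint_family_on P {..<k}"
      using disj by (auto simp: disjoint_family_on_def)
    show "(\<Union>i<k. P i) = D"
      using cover PD by blast
    then show "(\<Union>i<k. f ` P i) = f ` D"
      by blast
    show "disjoint_family_on (\<lambda>i. f ` P i) {..<k}"
      unfolding disjoint_family_on_def using disj PD inj_on_image_Int[OF assms(2)] by (metis image_empty)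
    show "\<exists>\<gamma>\<in>carrier \<Gamma>. f ` P i = \<phi> \<gamma> ` P i" if "i < k" for i
      using g[OF that] by (intro bexI[of _ "gs ! i"]) (auto simp: P_def image_iff)
  qed
  moreover have "\<forall>i<k. P i \<in> sets X \<and> f ` P i \<in> sets X"
    using P_sets PD bpt_image_sets[OF assms(1)] by blast
  ultimately show ?thesis
    unfolding borel_equidecomposable_def by blast
qed

lemma borel_schroeder_bernstein:
  assumes f: "borel_piecewise_translation F A f" "inj_on f A" "f ` A \<subseteq> B"
    and g: "borel_piecewise_translation F' B g" "inj_on g B" "g ` B \<subseteq> A"
  shows "borel_equidecomposable \<Gamma> X \<phi> A B"
proof -
  note fD = bptD[OF f(1)] and gD = bptD[OF g(1)]
  define C where "C = rec_nat (A - g ` B) (\<lambda>_ S. g ` f ` S)"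
  have C_simps: "C 0 = A - g ` B" "C (Suc n) = g ` f ` C n" for n
    by (simp_all add: C_def)
  have CA: "C n \<subseteq> A \<and> C n \<in> sets X" for n
  proof (induction n)
    case 0
    then show ?case
      using fD(3) bpt_image_sets[OF g(1) gD(3)] by (auto simp: C_simps)
  next
    case (Suc n)
    then have "f ` C n \<in> sets X" "f ` C n \<subseteq> B"
      using bpt_image_sets[OF f(1)] f(3) by auto
    then show ?case
      using bpt_image_sets[OF g(1)] g(3) by (auto simp: C_simps)
  qed
  define W where "W = (\<Union>n. C n)"
  have W: "W \<in> sets X" "W \<subseteq> A"
    using CA by (auto simp: W_def)
  have gfW: "g ` f ` W \<subseteq> W"
    unfolding W_def using C_simps(2) by blast
  have W_cases: "x \<in> g ` f ` W" if x: "x \<in> W" "x \<in> g ` B" for x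
  proof -
    obtain n where "x \<in> C n"
      using x(1) by (auto simp: W_def)
    with x(2) show ?thesis
      by (cases n) (auto simp: C_simps W_def)
  qed
  have AW: "A - W \<subseteq> g ` B"
    using C_simps(1) by (auto simp: W_def)
  define h where "h x = (if x \<in> W then f x else inv_into B g x)" for x
  have "A - W \<in> sets X"
    using W fD(3) by auto
  then have "borel_piecewise_translation (F \<union> m_inv \<Gamma> ` F') (W \<union> (A - W)) h"
    unfolding h_def using W AW
    by (intro bpt_If bpt_subset[OF f(1)] bpt_subset[OF bpt_inv_into[OF g(1,2)]])
  moreover have "W \<union> (A - W) = A"
    using W by auto
  ultimately have h: "borel_piecewise_translation (F \<union> m_inv \<Gamma> ` F') A h"
    by simp
  have ginv: "g (inv_into B g x) = x" "inv_into B g x \<in> B" if "x \<in> A - W" for x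
    using AW that f_inv_into_f inv_into_into by (metis subsetD)+
  have "inj_on h A"
  proof (rule inj_onI)
    have *: False if "x \<in> W" "y \<in> A - W" "f x = inv_into B g y" for x y
      using that ginv[OF that(2)] gfW by (metis DiffD2 image_eqI subsetD)
    fix x y assume "x \<in> A" "y \<in> A" "h x = h y"
    then show "x = y"
      using *[of x y] *[of y x] f(2) W ginv unfolding h_def inj_on_def
      by (metis DiffI)
  qed
  moreover have "h ` A = B"
  proof
    show "h ` A \<subseteq> B"
      using f(3) W ginv(2) by (auto simp: h_def)
    show "B \<subseteq> h ` A"
    proof
      fix y assume y: "y \<in> B"
      then have gy: "g y \<in> A"
        using g(3) by blast
      show "y \<in> h ` A"
      proof (cases "g y \<in> W")
        case True
        then obtain x where "x \<in> W" "g y = g (f x)"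
          using W_cases[of "g y"] y by blast
        then have "y = f x"
          using g(2) y f(3) W by (meson image_subset_iff inj_onD subsetD)
        then show ?thesis
          using \<open>x \<in> W\<close> W by (auto simp: h_def)
      next
        case False
        then show ?thesis
          using gy y g(2) by (intro image_eqI[of _ _ "g y"]) (auto simp: h_def)
      qed
    qed
  qed
  ultimately show ?thesis
    using bpt_imp_borel_equidecomposable[OF h] by simp
qed

end

section \<open>Borel matchings from expansion\<close>

context separated_borel_action
begin

section \<open>Components of the graph of bounded moves\<close>

definition step :: "'g set \<Rightarrow> 'x set \<Rightarrow> 'x \<Rightarrow> 'x \<Rightarrow> bool" where
  "step T D x y \<longleftrightarrow> x \<in> D \<and> y \<in> D \<and> (\<exists>\<tau>\<in>T. y = \<phi> \<tau> x)"

abbreviation chain :: "'g set \<Rightarrow> 'x set \<Rightarrow> 'x \<Rightarrow> 'x \<Rightarrow> bool" where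
  "chain T D \<equiv> (step T D)\<^sup>*\<^sup>*"

text \<open>Peeling off the last step of a chain replaces its end by another translate of the same
  variable point, at the price of a finite quantifier over \<open>T\<close>. Induction on the
  length, for all ends at once, and a countable union over lengths finish.\<close>

lemma orbit_borel_chain:
  assumes T: "finite T" "T \<subseteq> carrier \<Gamma>" and D [measurable]: "D \<in> sets X"
  shows "orbit_borel (chain T D)"
proof -
  have step_iff: "step T D z y \<longleftrightarrow> y \<in> D \<and> z \<in> D \<and> (\<exists>\<tau>\<in>T. z = \<phi> (inv \<tau>) y)" for z y
    using sets.sets_into_space[OF D] T(2) unfolding step_def by (metis act_act_inv act_inv_act subsetD)
  have "Measurable.pred X (\<lambda>x. (step T D ^^ n) (\<phi> \<gamma> x) (\<phi> \<delta> x))"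
    if "\<gamma> \<in> carrier \<Gamma>" "\<delta> \<in> carrier \<Gamma>" for n \<gamma> \<delta>
    using that
  proof (induction n arbitrary: \<delta>)
    case 0
    then show ?case
      by (simp add: pred_eq)
  next
    case (Suc n)
    have "Measurable.pred X (\<lambda>x. \<exists>\<tau>\<in>T. \<phi> \<delta> x \<in> D \<and> \<phi> (inv \<tau> \<otimes> \<delta>) x \<in> D \<and>
        (step T D ^^ n) (\<phi> \<gamma> x) (\<phi> (inv \<tau> \<otimes> \<delta>) x))"
    proof (intro pred_countable_bounded(2) pred_intros_logic(3))
      show "countable T"
        using T(1) by (rule countable_finite)
      fix \<tau> assume "\<tau> \<in> T"
      then have carr: "inv \<tau> \<otimes> \<delta> \<in> carrier \<Gamma>"
        using T(2) Suc.prems by auto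
      show "Measurable.pred X (\<lambda>x. \<phi> \<delta> x \<in> D)"
        "Measurable.pred X (\<lambda>x. \<phi> (inv \<tau> \<otimes> \<delta>) x \<in> D)"
        using carr Suc.prems by measurable
      show "Measurable.pred X (\<lambda>x. (step T D ^^ n) (\<phi> \<gamma> x) (\<phi> (inv \<tau> \<otimes> \<delta>) x))"
        using Suc.IH[OF Suc.prems(1) carr] .
    qed
    moreover have "(\<exists>\<tau>\<in>T. \<phi> \<delta> x \<in> D \<and> \<phi> (inv \<tau> \<otimes> \<delta>) x \<in> D \<and>
        (step T D ^^ n) (\<phi> \<gamma> x) (\<phi> (inv \<tau> \<otimes> \<delta>) x)) \<longleftrightarrow>
        (step T D ^^ Suc n) (\<phi> \<gamma> x) (\<phi> \<delta> x)" if "x \<in> space X" for x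
    proof -
      have "\<phi> (inv \<tau> \<otimes> \<delta>) x = \<phi> (inv \<tau>) (\<phi> \<delta> x)" if "\<tau> \<in> T" for \<tau>
        using that T(2) Suc.prems \<open>x \<in> space X\<close> by auto
      then show ?thesis
        unfolding relpowp.simps relcompp_apply step_iff by auto
    qed
    ultimately show ?case
      by (simp cong: measurable_cong)
  qed
  then have "Measurable.pred X (\<lambda>x. \<exists>n. (step T D ^^ n) (\<phi> \<gamma> x) (\<phi> \<delta> x))"
    if "\<gamma> \<in> carrier \<Gamma>" "\<delta> \<in> carrier \<Gamma>" for \<gamma> \<delta>
    using that by (intro pred_intros_countable)
  then show ?thesis
    unfolding orbit_borel_def rtranclp_power by blast
qed

lemma chain_in:
  assumes "chain T D x y" "x \<in> D"
  shows "y \<in> D"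
  using assms by (induction rule: rtranclp_induct) (auto simp: step_def)

lemma chain_sym:
  assumes "T \<subseteq> carrier \<Gamma>" "m_inv \<Gamma> ` T \<subseteq> T" "D \<subseteq> space X" "chain T D x y"
  shows "chain T D y x"
proof -
  have "step T D z y" if st: "step T D y z" for y z
  proof -
    obtain \<tau> where "y \<in> D" "z \<in> D" "\<tau> \<in> T" "z = \<phi> \<tau> y"
      using st unfolding step_def by blast
    moreover from this have "y = \<phi> (inv \<tau>) z"
      using assms(1,3) by (metis act_inv_act subsetD)
    ultimately show ?thesis
      using assms(2) unfolding step_def by blast
  qed
  then have "symp (step T D)"
    by (rule sympI)
  then show ?thesis
    using assms(4) by (meson symp_rtranclp sympD)
qed

lemma chain_orbit:
  assumes "T \<subseteq> carrier \<Gamma>" "D \<subseteq> space X" "chain T D x y" "x \<in> D"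
  shows "\<exists>\<gamma>\<in>carrier \<Gamma>. y = \<phi> \<gamma> x"
  using assms(3)
proof (induction rule: rtranclp_induct)
  case base
  show ?case
    using assms(2,4) by (intro bexI[of _ \<one>]) auto
next
  case (step y z)
  then obtain \<gamma> \<tau> where \<gamma>: "\<gamma> \<in> carrier \<Gamma>" "y = \<phi> \<gamma> x" "\<tau> \<in> T" "z = \<phi> \<tau> y"
    unfolding step_def by blast
  moreover have "\<tau> \<in> carrier \<Gamma>" "x \<in> space X"
    using \<gamma>(3) assms by auto
  ultimately have "z = \<phi> (\<tau> \<otimes> \<gamma>) x" "\<tau> \<otimes> \<gamma> \<in> carrier \<Gamma>"
    by auto
  then show ?case
    by blast
qed

text \<open>A move by \<open>T\<close> spans distance at most \<open>k\<close>, so it is an edge of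
  the k-th power graph or stays put; a chain inside \<open>D\<close> therefore never leaves a
  component of that graph on \<open>U\<close>.\<close>

lemma finite_chain:
  assumes fin: "graph_finite (power_edges (space X) E k) U"
    and DU: "D \<subseteq> U" and D: "D \<subseteq> space X"
    and T: "\<And>\<tau> x. \<tau> \<in> T \<Longrightarrow> x \<in> space X \<Longrightarrow> reach (space X) E k x (\<phi> \<tau> x)"
    and x: "x \<in> D"
  shows "finite {y. chain T D x y}"
proof -
  let ?I = "induced_edges (power_edges (space X) E k) U"
  have "\<exists>p. graph_walk U ?I x p y" if "chain T D x y" for y
    using that
  proof (induction rule: rtranclp_induct)
    case base
    show ?case
      using x DU by (intro exI[of _ "[x]"]) (auto simp: graph_walk_def)
  next
    case (step y z)
    then obtain p where p: "graph_walk U ?I x p y"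
      by blast
    obtain \<tau> where \<tau>: "y \<in> D" "z \<in> D" "\<tau> \<in> T" "z = \<phi> \<tau> y"
      using step.hyps(2) unfolding step_def by blast
    show ?case
    proof (cases "y = z")
      case False
      have "reach (space X) E k y z"
        using T[OF \<tau>(3)] \<tau> D by blast
      moreover have "0 < graph_dist (space X) E y z"
        using graph_dist_pos_iff[of y "space X" E z] False \<tau>(1) D by blast
      ultimately have "{y, z} \<in> power_edges (space X) E k"
        unfolding power_edges_def graph_dist_le_iff using \<tau>(1,2) D by blast
      then have "{y, z} \<in> ?I"
        using \<tau>(1,2) DU by (auto simp: induced_edges_def)
      then have "graph_walk U ?I y [y, z] z"
        using \<tau>(1,2) DU by (auto simp: graph_walk_def)
      then show ?thesis
        using graph_walk_trans[OF p] by blast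
    qed (use p in blast)
  qed
  moreover have "y \<in> U" if "chain T D x y" for y
    using chain_in[OF that x] DU by blast
  ultimately have "{y. chain T D x y} \<subseteq> graph_component U ?I x"
    by (auto simp: graph_component_def)
  moreover have "finite (graph_component U ?I x)"
    using fin x DU by (auto simp: graph_finite_def)
  ultimately show ?thesis
    by (rule finite_subset)
qed

section \<open>Reserving points in pairs\<close>

text \<open>If \<open>x\<close> and \<open>y\<close> can be moved by \<open>F\<close> to the same point, or to two points reserved for one
  and the same \<open>a\<close>, then \<open>y\<close> is a translate of \<open>x\<close> by an element of this set.\<close>

definition conflict_translates :: "'g set \<Rightarrow> 'g set" where
  "conflict_translates F = {inv \<gamma>1 \<otimes> (\<gamma>2 \<otimes> (inv \<gamma>3 \<otimes> \<gamma>4)) | \<gamma>1 \<gamma>2 \<gamma>3 \<gamma>4.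
     \<gamma>1 \<in> F \<and> \<gamma>2 \<in> F \<and> \<gamma>3 \<in> F \<and> \<gamma>4 \<in> F}"

text \<open>Inverting a word of this shape reverses its letters and gives the same shape. Closure
  under inverses makes \<open>chain\<close> symmetric.\<close>

lemma conflict_translates:
  assumes "finite F" "F \<subseteq> carrier \<Gamma>"
  shows "finite (conflict_translates F)" "conflict_translates F \<subseteq> carrier \<Gamma>"
    "m_inv \<Gamma> ` conflict_translates F \<subseteq> conflict_translates F"
proof -
  have "conflict_translates F = (\<lambda>(\<gamma>1, \<gamma>2, \<gamma>3, \<gamma>4). inv \<gamma>1 \<otimes> (\<gamma>2 \<otimes> (inv \<gamma>3 \<otimes> \<gamma>4))) ` (F \<times> F \<times> F \<times> F)"
    unfolding conflict_translates_def by force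
  then show "finite (conflict_translates F)"
    using assms(1) by simp
  show "conflict_translates F \<subseteq> carrier \<Gamma>"
    using assms(2) unfolding conflict_translates_def by blast
  show "m_inv \<Gamma> ` conflict_translates F \<subseteq> conflict_translates F"
  proof (rule image_subsetI)
    fix \<tau> assume "\<tau> \<in> conflict_translates F"
    then obtain a b c d where F: "a \<in> F" "b \<in> F" "c \<in> F" "d \<in> F"
      and \<tau>: "\<tau> = inv a \<otimes> (b \<otimes> (inv c \<otimes> d))"
      unfolding conflict_translates_def by blast
    have "a \<in> carrier \<Gamma>" "b \<in> carrier \<Gamma>" "c \<in> carrier \<Gamma>" "d \<in> carrier \<Gamma>"
      using F assms(2) by auto
    then have "inv \<tau> = inv d \<otimes> (c \<otimes> (inv b \<otimes> a))"
      unfolding \<tau> by (simp add: inv_mult_group m_assoc)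
    then show "inv \<tau> \<in> conflict_translates F"
      using F unfolding conflict_translates_def by blast
  qed
qed

text \<open>The reserve of a point is stored as \<open>m\<close> separate maps, so that each is a
  Borel piecewise translation. Joint injectivity also separates different indices at the same
  point.\<close>

definition borel_multimatching ::
  "'g set \<Rightarrow> 'x set \<Rightarrow> 'x set \<Rightarrow> nat \<Rightarrow> (nat \<Rightarrow> 'x \<Rightarrow> 'x) \<Rightarrow> bool" where
  "borel_multimatching F D B m c \<longleftrightarrow>
     (\<forall>t<m. borel_piecewise_translation F D (c t) \<and> c t ` D \<subseteq> B) \<and>
     inj_on (\<lambda>(t, x). c t x) ({..<m} \<times> D)"

text \<open>One stage, with index \<open>t\<close> paired with \<open>t + m\<close>. New points are
  matched through the quotient map \<open>q\<close>, which is at most two-to-one; the factor 2 in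
  the expansion hypothesis compensates for this.\<close>

lemma extend_borel_multimatching:
  assumes F: "finite F" "F \<subseteq> carrier \<Gamma>"
    and D: "D \<in> sets X" and B: "B \<in> sets X" and disj: "D \<inter> D' = {}"
    and c: "borel_multimatching F D' B (2 * m) c"
    and expansion: "\<And>S. finite S \<Longrightarrow> S \<subseteq> D \<Longrightarrow> 2 * m * card S \<le> card (translates F S \<inter> B)"
    and fin: "\<And>x. x \<in> D \<Longrightarrow> finite {y. chain (conflict_translates F) D x y}"
    and D': "D' \<in> sets X"
  shows "\<exists>c'. borel_multimatching F (D \<union> D') B m c'"
proof -
  note T = conflict_translates[OF F]
  let ?T = "conflict_translates F"
  have DX: "D \<subseteq> space X" "D' \<subseteq> space X" "B \<subseteq> space X"
    using D D' B sets.sets_into_space by auto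
  have c_bpt: "borel_piecewise_translation F D' (c t)" and cB: "\<And>x. x \<in> D' \<Longrightarrow> c t x \<in> B" if "t < 2 * m" for t
    using c that by (auto simp: borel_multimatching_def)
  have c_inj: "t = t' \<and> x = x'" if "c t x = c t' x'" "t < 2 * m" "t' < 2 * m" "x \<in> D'" "x' \<in> D'" for t t' x x'
    using c that unfolding borel_multimatching_def inj_on_def by fastforce
  \<comment> \<open>The upper members of all pairs. They are the points that \<open>q\<close> sends
    to their partners; every other point is fixed.\<close>
  define H where "H = (\<Union>t<m. c (t + m) ` D')"
  define J where "J = inv_into ({..<m} \<times> D') (\<lambda>(t, x). c (t + m) x)"
  \<comment> \<open>\<open>q\<close> identifies the two points \<open>c t a\<close> and \<open>c (t + m) a\<close> of a pair. If the new reservations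
    remain distinct under \<open>q\<close>, they hit every pair at most once.\<close>
  define q where "q b = (if b \<in> H then (\<lambda>(t, x). c t x) (J b) else b)" for b
  have J: "J (c (t + m) a) = (t, a)" if "t < m" "a \<in> D'" for t a
  proof -
    have "inj_on (\<lambda>(t, x). c (t + m) x) ({..<m} \<times> D')"
      by (intro inj_onI) (auto dest: c_inj)
    then show ?thesis
      using that inv_into_f_f[of "\<lambda>(t, x). c (t + m) x" "{..<m} \<times> D'" "(t, a)"] by (simp add: J_def)
  qed
  have q_hi: "q (c (t + m) a) = c t a" if "t < m" "a \<in> D'" for t a
    using that J by (auto simp: q_def H_def)
  have q_lo: "q (c t a) = c t a" if "t < m" "a \<in> D'" for t a
  proof -
    have "c t a \<notin> H"
      using that by (auto simp: H_def dest: c_inj)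
    then show ?thesis
      by (simp add: q_def)
  qed
  have q_out: "q b = b" if "b \<notin> H" for b
    using that by (simp add: q_def)
  have H_cases: "\<exists>t a. t < m \<and> a \<in> D' \<and> b = c (t + m) a" if "b \<in> H" for b
    using that by (auto simp: H_def)
  have H: "H \<in> sets X"
    unfolding H_def using D' by (intro sets.finite_UN bpt_image_sets[OF c_bpt]) auto
  have q_H: "q b = q b' \<Longrightarrow> b = b'" if b: "b \<in> H" "b' \<in> H" for b b'
  proof -
    assume "q b = q b'"
    obtain t a t' a' where "t < m" "a \<in> D'" "b = c (t + m) a" "t' < m" "a' \<in> D'" "b' = c (t' + m) a'"
      using H_cases b by meson
    with \<open>q b = q b'\<close> show ?thesis
      using q_hi c_inj[of t a t' a'] by auto
  qed
  have q_measurable: "q \<in> X \<rightarrow>\<^sub>M X"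
  proof (rule measurableI)
    fix b assume "b \<in> space X"
    show "q b \<in> space X"
    proof (cases "b \<in> H")
      case True
      then obtain t a where "t < m" "a \<in> D'" "b = c (t + m) a"
        using H_cases by blast
      then show ?thesis
        using q_hi cB[of t a] DX(3) by auto
    qed (use \<open>b \<in> space X\<close> q_out in simp)
  next
    fix C assume C: "C \<in> sets X"
    have "q -` C \<inter> space X = (C - H) \<union> (\<Union>t<m. c (t + m) ` {a \<in> D'. c t a \<in> C})"
    proof (intro equalityI subsetI)
      fix b assume b: "b \<in> q -` C \<inter> space X"
      show "b \<in> (C - H) \<union> (\<Union>t<m. c (t + m) ` {a \<in> D'. c t a \<in> C})"
      proof (cases "b \<in> H")
        case True
        then obtain t a where ta: "t < m" "a \<in> D'" "b = c (t + m) a"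
          using H_cases by blast
        then have "c t a \<in> C"
          using b q_hi by simp
        then show ?thesis
          using ta by blast
      qed (use b q_out in auto)
    next
      fix b assume "b \<in> (C - H) \<union> (\<Union>t<m. c (t + m) ` {a \<in> D'. c t a \<in> C})"
      then consider "b \<in> C" "b \<notin> H" | t a where "t < m" "a \<in> D'" "c t a \<in> C" "b = c (t + m) a"
        by blast
      then show "b \<in> q -` C \<inter> space X"
      proof cases
        case 1
        then show ?thesis
          using q_out sets.sets_into_space[OF C] by auto
      next
        case 2
        then show ?thesis
          using q_hi cB[of "t + m" a] DX(3) by auto
      qed
    qed
    also have "\<dots> \<in> sets X"
      using C H bptD(7)[OF c_bpt C] by (intro sets.Un sets.Diff sets.finite_UN bpt_image_sets[OF c_bpt]) auto
    finally show "q -` C \<inter> space X \<in> sets X" .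
  qed
  \<comment> \<open>\<open>q\<close> is injective on \<open>H\<close> and is the identity off
    \<open>H\<close>, so no value is taken more than twice.\<close>
  have card_q: "card S \<le> 2 * card (q ` S)" if S: "finite S" for S
  proof -
    have "inj_on q (S \<inter> H)"
      using q_H by (auto intro: inj_onI)
    then have "card (S \<inter> H) = card (q ` (S \<inter> H))"
      by (rule card_image[symmetric])
    also have "\<dots> \<le> card (q ` S)"
      using S by (intro card_mono) auto
    finally have 1: "card (S \<inter> H) \<le> card (q ` S)" .
    have "inj_on q (S - H)"
      using q_out by (auto intro: inj_onI)
    then have "card (S - H) = card (q ` (S - H))"
      by (rule card_image[symmetric])
    also have "\<dots> \<le> card (q ` S)"
      using S by (intro card_mono) auto
    finally have 2: "card (S - H) \<le> card (q ` S)" .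
    have "S \<inter> H \<union> (S - H) = S"
      by blast
    then have "card S = card (S \<inter> H) + card (S - H)"
      using card_Un_disjoint[of "S \<inter> H" "S - H"] S by auto
    with 1 2 show ?thesis
      by simp
  qed
  have c_act: "\<exists>\<delta>\<in>F. c t a = \<phi> \<delta> a" if "t < 2 * m" "a \<in> D'" for t a
    using bptD(4)[OF c_bpt[OF that(1)]] that(2) unfolding piecewise_translation_on_def by blast
  \<comment> \<open>Equal values of \<open>q\<close> mean equal points or the two points of one
    pair. In both cases the points are translates by \<open>F\<close> of a common point,
    \<open>x\<close> itself or the owner of the pair, and travelling through it uses four
    letters.\<close>
  have conflict: "\<exists>\<tau>\<in>?T. y = \<phi> \<tau> x"
    if xy: "x \<in> D" "y \<in> D" "\<gamma> \<in> F" "\<delta> \<in> F" "q (\<phi> \<gamma> x) = q (\<phi> \<delta> y)" for x y \<gamma> \<delta>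
  proof -
    have X: "x \<in> space X" "y \<in> space X" "\<gamma> \<in> carrier \<Gamma>" "\<delta> \<in> carrier \<Gamma>"
      using xy DX F by auto
    have "\<exists>a \<epsilon> \<epsilon>'. a \<in> space X \<and> \<epsilon> \<in> F \<and> \<epsilon>' \<in> F \<and> \<phi> \<gamma> x = \<phi> \<epsilon> a \<and> \<phi> \<delta> y = \<phi> \<epsilon>' a"
    proof (cases "\<phi> \<gamma> x \<in> H \<longleftrightarrow> \<phi> \<delta> y \<in> H")
      case True
      then have "\<phi> \<gamma> x = \<phi> \<delta> y"
        using xy(5) q_H q_out by metis
      then show ?thesis
        using X xy by blast
    next
      case False
      have *: "\<exists>a \<epsilon> \<epsilon>'. a \<in> space X \<and> \<epsilon> \<in> F \<and> \<epsilon>' \<in> F \<and> b = \<phi> \<epsilon> a \<and> b' = \<phi> \<epsilon>' a"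
        if b: "b \<in> H" "b' \<notin> H" "q b = q b'" for b b'
      proof -
        obtain t a where ta: "t < m" "a \<in> D'" "b = c (t + m) a"
          using H_cases b(1) by blast
        then have "b' = c t a"
          using b q_out q_hi by metis
        then show ?thesis
          using c_act[of t a] c_act[of "t + m" a] ta DX(2) by auto
      qed
      from False show ?thesis
        using *[of "\<phi> \<gamma> x" "\<phi> \<delta> y"] *[of "\<phi> \<delta> y" "\<phi> \<gamma> x"] xy(5) by (cases "\<phi> \<gamma> x \<in> H") auto
    qed
    then obtain a \<epsilon> \<epsilon>' where a: "a \<in> space X" "\<epsilon> \<in> F" "\<epsilon>' \<in> F" "\<phi> \<gamma> x = \<phi> \<epsilon> a" "\<phi> \<delta> y = \<phi> \<epsilon>' a"
      by blast
    have \<epsilon>: "\<epsilon> \<in> carrier \<Gamma>" "\<epsilon>' \<in> carrier \<Gamma>"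
      using a F by auto
    have "\<phi> (inv \<delta> \<otimes> (\<epsilon>' \<otimes> (inv \<epsilon> \<otimes> \<gamma>))) x = \<phi> (inv \<delta>) (\<phi> \<epsilon>' (\<phi> (inv \<epsilon>) (\<phi> \<gamma> x)))"
      using X \<epsilon> by simp
    also have "\<phi> (inv \<epsilon>) (\<phi> \<gamma> x) = a"
      unfolding a(4) using a(1) \<epsilon>(1) by simp
    also have "\<phi> (inv \<delta>) (\<phi> \<epsilon>' a) = y"
      unfolding a(5)[symmetric] using X by simp
    finally have "y = \<phi> (inv \<delta> \<otimes> (\<epsilon>' \<otimes> (inv \<epsilon> \<otimes> \<gamma>))) x"
      by (rule sym)
    then show ?thesis
      using xy(3,4) a(2,3) unfolding conflict_translates_def by blast
  qed
  \<comment> \<open>A label chooses a move for each of the \<open>m\<close> indices; taking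
    extensional functions makes the set of labels finite.\<close>
  define L where "L = (\<Pi>\<^sub>E t\<in>{..<m}. F)"
  have L_fin: "finite L"
    unfolding L_def using F(1) by (intro finite_PiE) auto
  have L: "l t \<in> F" "l t \<in> carrier \<Gamma>" if "l \<in> L" "t < m" for l t
    using that F(2) by (auto simp: L_def)
  \<comment> \<open>The condition on \<open>x\<close> alone can be put into the binary relation
    because chains are reflexive. The case of equal points also keeps the \<open>m\<close>
    reservations of one point apart.\<close>
  define R where "R l x l' y \<longleftrightarrow> (\<forall>t\<in>{..<m}. \<phi> (l t) x \<in> B) \<and>
      (\<forall>t\<in>{..<m}. \<forall>t'\<in>{..<m}. \<not> (x = y \<and> t = t') \<longrightarrow> \<not> q (\<phi> (l t) x) = q (\<phi> (l' t') y))" for l x l' y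
  have "\<exists>cl. (\<forall>x\<in>D. cl x \<in> L) \<and> (\<forall>l. {x\<in>D. cl x = l} \<in> sets X) \<and>
    (\<forall>x\<in>D. \<forall>y. chain ?T D x y \<longrightarrow> R (cl x) x (cl y) y)"
  proof (rule borel_csp[OF D orbit_borel_chain[OF T(1,2) D]])
    show "countable L"
      using L_fin by (rule countable_finite)
    show "y \<in> D" if "x \<in> D" "chain ?T D x y" for x y
      using chain_in that by blast
    show "chain ?T D y x" if "x \<in> D" "chain ?T D x y" for x y
      using chain_sym[OF T(2,3) DX(1)] that by blast
    show "\<exists>\<gamma>\<in>carrier \<Gamma>. y = \<phi> \<gamma> x" if "x \<in> D" "chain ?T D x y" for x y
      using chain_orbit[OF T(2) DX(1)] that by blast
    show "finite {y. chain ?T D x y}" if "x \<in> D" for x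
      using fin[OF that] .
  next
    fix l l' assume l: "l \<in> L" "l' \<in> L"
    show "orbit_borel (\<lambda>x y. R l x l' y)"
      unfolding orbit_borel_def
    proof (intro ballI)
      fix \<gamma> \<delta> assume \<gamma>: "\<gamma> \<in> carrier \<Gamma>" "\<delta> \<in> carrier \<Gamma>"
      have m1: "(\<lambda>x. \<phi> (l t) (\<phi> \<gamma> x)) \<in> X \<rightarrow>\<^sub>M X" if "t < m" for t
        using measurable_compose[OF act_measurable[OF \<gamma>(1)] act_measurable[OF L(2)[OF l(1) that]]] .
      have m2: "(\<lambda>x. \<phi> (l' t) (\<phi> \<delta> x)) \<in> X \<rightarrow>\<^sub>M X" if "t < m" for t
        using measurable_compose[OF act_measurable[OF \<gamma>(2)] act_measurable[OF L(2)[OF l(2) that]]] .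
      have pB: "Measurable.pred X (\<lambda>x. \<phi> (l t) (\<phi> \<gamma> x) \<in> B)" if "t < m" for t
        using pred_sets2[OF B m1[OF that]] .
      have pq: "Measurable.pred X (\<lambda>x. q (\<phi> (l t) (\<phi> \<gamma> x)) = q (\<phi> (l' t') (\<phi> \<delta> x)))"
        if "t < m" "t' < m" for t t'
        using that by (intro pred_eq measurable_compose[OF m1 q_measurable] measurable_compose[OF m2 q_measurable])
      have pe: "Measurable.pred X (\<lambda>x. \<phi> \<gamma> x = \<phi> \<delta> x)"
        using \<gamma> by (intro pred_eq act_measurable)
      have pc: "Measurable.pred X (\<lambda>x. K)" for K
        by simp
      show "Measurable.pred X (\<lambda>x. R l (\<phi> \<gamma> x) l' (\<phi> \<delta> x))"
        unfolding R_def
        by (intro pred_intros_logic(2-4) pred_countable_bounded(1) pB pq pe pc) auto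
    qed
  next
    fix K assume K: "finite K" "K \<subseteq> D"
    \<comment> \<open>Hall's theorem is applied to \<open>m\<close> copies of each point, with
      targets taken modulo \<open>q\<close>. For slots over \<open>S\<close> the count is at most
      \<open>m * card S\<close>, while expansion and \<open>card_q\<close> provide that many
      targets.\<close>
    define N where "N = (\<lambda>(x, t::nat). q ` (translates F {x} \<inter> B))"
    have "\<exists>h. inj_on h (K \<times> {..<m}) \<and> (\<forall>i\<in>K \<times> {..<m}. h i \<in> N i)"
    proof (rule finite_hall)
      show "finite (K \<times> {..<m})"
        using K(1) by simp
      show "finite (N i)" for i
        using finite_translates[OF F(1)] by (auto simp: N_def split: prod.splits)
      fix I assume I: "I \<subseteq> K \<times> {..<m}"
      define S where "S = fst ` I"
      have S: "S \<subseteq> K"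
        using I by (auto simp: S_def)
      then have "finite S"
        using K(1) by (rule finite_subset)
      note S = this S
      have "I \<subseteq> S \<times> {..<m}"
        using I by (force simp: S_def)
      then have "card I \<le> card (S \<times> {..<m})"
        using S(1) by (intro card_mono) auto
      then have "2 * card I \<le> 2 * m * card S"
        by (simp add: card_cartesian_product mult.commute)
      also have "\<dots> \<le> card (translates F S \<inter> B)"
        using S K(2) by (intro expansion) auto
      also have "\<dots> \<le> 2 * card (q ` (translates F S \<inter> B))"
        using finite_translates[OF F(1) S(1)] by (intro card_q) auto
      also have "q ` (translates F S \<inter> B) = \<Union>(N ` I)"
        by (force simp: N_def S_def translates_def)
      finally show "card I \<le> card (\<Union>(N ` I))"
        by simp
    qed
    then obtain h where h: "inj_on h (K \<times> {..<m})" "\<And>x t. x \<in> K \<Longrightarrow> t < m \<Longrightarrow> h (x, t) \<in> N (x, t)"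
      by auto
    have "\<exists>\<gamma>\<in>F. \<phi> \<gamma> x \<in> B \<and> h (x, t) = q (\<phi> \<gamma> x)" if "x \<in> K" "t < m" for x t
      using h(2)[OF that] by (auto simp: N_def translates_def)
    then obtain g where g: "\<And>x t. x \<in> K \<Longrightarrow> t < m \<Longrightarrow>
        g x t \<in> F \<and> \<phi> (g x t) x \<in> B \<and> h (x, t) = q (\<phi> (g x t) x)"
      by metis
    have "R (restrict (g x) {..<m}) x (restrict (g y) {..<m}) y" if "x \<in> K" "y \<in> K" for x y
      unfolding R_def
    proof (intro conjI ballI impI)
      fix t t' assume t: "t \<in> {..<m}" "t' \<in> {..<m}" "\<not> (x = y \<and> t = t')"
      then have "h (x, t) \<noteq> h (y, t')"
        using inj_onD[OF h(1), of "(x, t)" "(y, t')"] that by auto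
      then show "\<not> q (\<phi> (restrict (g x) {..<m} t) x) = q (\<phi> (restrict (g y) {..<m} t') y)"
        using g[of x t] g[of y t'] t that by simp
    qed (use g that in auto)
    moreover have "restrict (g x) {..<m} \<in> L" if "x \<in> K" for x
      using g that by (auto simp: L_def)
    ultimately show "\<exists>cl. \<forall>x\<in>K. cl x \<in> L \<and> (\<forall>y\<in>K. R (cl x) x (cl y) y)"
      by (intro exI[of _ "\<lambda>x. restrict (g x) {..<m}"]) blast
  qed auto
  then obtain cl where cl: "\<And>x. x \<in> D \<Longrightarrow> cl x \<in> L" "\<And>l. {x\<in>D. cl x = l} \<in> sets X"
    "\<And>x y. x \<in> D \<Longrightarrow> chain ?T D x y \<Longrightarrow> R (cl x) x (cl y) y"
    by blast
  define g where "g t x = \<phi> (cl x t) x" for t x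
  have g_bpt: "borel_piecewise_translation F D (g t)" if t: "t < m" for t
    unfolding borel_piecewise_translation_def
  proof (intro conjI ballI F D)
    show "piecewise_translation_on F D (g t)"
      using L(1)[OF cl(1) t] by (auto simp: piecewise_translation_on_def g_def)
    fix C assume C: "C \<in> sets X"
    have "{x \<in> D. g t x \<in> C} = (\<Union>l\<in>L. {x\<in>D. cl x = l} \<inter> (\<phi> (l t) -` C \<inter> space X))"
      using cl(1) DX by (auto simp: g_def)
    also have "\<dots> \<in> sets X"
      by (intro sets.finite_UN L_fin sets.Int cl(2) measurable_sets[OF act_measurable C] L(2)[OF _ t])
    finally show "{x \<in> D. g t x \<in> C} \<in> sets X" .
  qed
  have gB: "g t x \<in> B" if "t < m" "x \<in> D" for t x
    using cl(3)[of x x] that by (auto simp: R_def g_def)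
  \<comment> \<open>The labels were chosen class by class, yet distinctness is global: equal values
    of \<open>q\<close> produce a conflict translate and so put both points into one class.\<close>
  have g_inj: "x = y \<and> t = t'" if "x \<in> D" "y \<in> D" "t < m" "t' < m" "q (g t x) = q (g t' y)" for x y t t'
  proof -
    have "\<exists>\<tau>\<in>?T. y = \<phi> \<tau> x"
      using conflict[of x y "cl x t" "cl y t'"] that L(1) cl(1) by (auto simp: g_def)
    then have "chain ?T D x y"
      using that by (intro r_into_rtranclp) (auto simp: step_def)
    then have "R (cl x) x (cl y) y"
      using cl(3) that by blast
    then show ?thesis
      using that unfolding R_def g_def by (metis lessThan_iff)
  qed
  define G where "G = (\<Union>t<m. g t ` D)"
  have G: "G \<in> sets X"
    unfolding G_def using D by (intro sets.finite_UN bpt_image_sets[OF g_bpt]) auto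
  \<comment> \<open>An old point keeps the lower member of each pair unless a new point took it, and
    the upper member otherwise.\<close>
  define c' where "c' t x = (if x \<in> D then g t x else if x \<in> {a \<in> D'. c t a \<in> G} then c (t + m) x else c t x)" for t x
  have old: "q (c' t a) = c t a" "c' t a \<notin> G" "c' t a \<in> B" if ta: "t < m" "a \<in> D'" for t a
  proof -
    have nD: "a \<notin> D"
      using ta disj by blast
    show "q (c' t a) = c t a"
      using nD ta q_hi q_lo by (auto simp: c'_def)
    show "c' t a \<in> B"
      using nD ta cB by (auto simp: c'_def)
    show "c' t a \<notin> G"
    proof (cases "c t a \<in> G")
      case True
      then obtain s x where x: "s < m" "x \<in> D" "c t a = g s x"
        by (auto simp: G_def)
      \<comment> \<open>If both members were taken, their common value under \<open>q\<close> would
        make the two new reservations, hence the two members, coincide.\<close>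
      have "c (t + m) a \<notin> G"
      proof
        assume "c (t + m) a \<in> G"
        then obtain s' x' where x': "s' < m" "x' \<in> D" "c (t + m) a = g s' x'"
          by (auto simp: G_def)
        have "q (g s x) = q (g s' x')"
          using q_hi[OF ta] q_lo[OF ta] x(3) x'(3) by simp
        then have "c t a = c (t + m) a"
          using g_inj[of x x' s s'] x x' by simp
        then show False
          using c_inj[of t a "t + m" a] ta by simp
      qed
      then show ?thesis
        using nD ta True by (simp add: c'_def)
    qed (use nD in \<open>simp add: c'_def\<close>)
  qed
  have new: "c' t x = g t x" "c' t x \<in> G" "c' t x \<in> B" if "t < m" "x \<in> D" for t x
    using that gB by (auto simp: c'_def G_def)
  have "borel_piecewise_translation F (D \<union> D') (c' t)" if t: "t < m" for t
  proof -
    let ?P = "{a \<in> D'. c t a \<in> G}"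
    have "?P \<in> sets X"
      using bptD(7)[OF c_bpt G] t by simp
    then have "borel_piecewise_translation (F \<union> F) (?P \<union> D') (\<lambda>x. if x \<in> ?P then c (t + m) x else c t x)"
      using t by (intro bpt_If bpt_subset[OF c_bpt[of "t + m"]] c_bpt) auto
    moreover have "?P \<union> D' = D'"
      by blast
    ultimately have "borel_piecewise_translation F D' (\<lambda>x. if x \<in> ?P then c (t + m) x else c t x)"
      by simp
    from bpt_If[OF g_bpt[OF t] this] show ?thesis
      unfolding c'_def by simp
  qed
  moreover have "inj_on (\<lambda>(t, x). c' t x) ({..<m} \<times> (D \<union> D'))"
  proof (rule inj_onI, clarify)
    fix t x t' x'
    assume *: "t < m" "t' < m" "c' t x = c' t' x'"
      "x \<in> D \<union> D'" "x' \<in> D \<union> D'"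
    \<comment> \<open>New reservations lie in \<open>G\<close> and old ones avoid it, so a collision
      cannot mix the two kinds.\<close>
    have "x \<in> D \<and> x' \<in> D \<or> x \<in> D' \<and> x' \<in> D'"
      using * new(2)[of t x] new(2)[of t' x'] old(2)[of t x] old(2)[of t' x'] by auto
    then show "t = t' \<and> x = x'"
    proof
      assume "x \<in> D \<and> x' \<in> D"
      then show ?thesis
        using * new(1) g_inj[of x x' t t'] by simp
    next
      assume "x \<in> D' \<and> x' \<in> D'"
      \<comment> \<open>Whichever member was kept, \<open>q\<close> returns the lower one, so
        injectivity is inherited from \<open>c\<close>.\<close>
      then have "c t x = c t' x'"
        using * old(1)[of t x] old(1)[of t' x'] by simp
      then show ?thesis
        using c_inj[of t x t' x'] * \<open>x \<in> D' \<and> x' \<in> D'\<close> by simp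
    qed
  qed
  ultimately show ?thesis
    unfolding borel_multimatching_def using old(3) new(3) by (intro exI[of _ c']) blast
qed

section \<open>The iteration over the cover\<close>

lemma borel_matching:
  assumes S: "finite_generating_set \<Gamma> S"
    and asi: "asi_graph X (schreier_edges (space X) \<phi> S) < \<infinity>"
    and A: "A \<in> sets X" and B: "B \<in> sets X"
    and expansion: "\<And>N. \<exists>F. finite F \<and> F \<subseteq> carrier \<Gamma> \<and>
      (\<forall>K. finite K \<longrightarrow> K \<subseteq> A \<longrightarrow> N * card K \<le> card (translates F K \<inter> B))"
  shows "\<exists>F f. borel_piecewise_translation F A f \<and> inj_on f A \<and> f ` A \<subseteq> B"
proof -
  let ?E = "schreier_edges (space X) \<phi> S"
  obtain s where s: "\<forall>k. \<exists>U :: nat \<Rightarrow> 'x set.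
      (\<forall>i\<le>s. U i \<in> sets X \<and> graph_finite (power_edges (space X) ?E k) (U i)) \<and> space X = (\<Union>i\<le>s. U i)"
    using asi unfolding asi_graph_def Inf_less_iff by blast
  \<comment> \<open>The cover has \<open>Suc s\<close> sets, because the indices run from 0 to
    \<open>s\<close>, and each stage costs a factor 2.\<close>
  obtain F where F: "finite F" "F \<subseteq> carrier \<Gamma>"
    "\<And>K. finite K \<Longrightarrow> K \<subseteq> A \<Longrightarrow> 2 ^ Suc s * card K \<le> card (translates F K \<inter> B)"
    using expansion[of "2 ^ Suc s"] by blast
  let ?T = "conflict_translates F"
  note T = conflict_translates[OF F(1,2)]
  have "\<forall>\<tau>\<in>?T. \<exists>n. \<forall>x\<in>space X. reach (space X) ?E n x (\<phi> \<tau> x)"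
    using schreier_reach[OF group_action_axioms, of S] S T(2) unfolding finite_generating_set_def by blast
  then obtain n where n: "\<And>\<tau> x. \<tau> \<in> ?T \<Longrightarrow> x \<in> space X \<Longrightarrow> reach (space X) ?E (n \<tau>) x (\<phi> \<tau> x)"
    by metis
  \<comment> \<open>The sum dominates the displacement of every conflict translate at once.\<close>
  define k where "k = sum n ?T"
  have k: "reach (space X) ?E k x (\<phi> \<tau> x)" if "\<tau> \<in> ?T" "x \<in> space X" for \<tau> x
    using reach_mono[OF n[OF that]] member_le_sum[of \<tau> ?T n] that T(1) by (simp add: k_def)
  obtain U :: "nat \<Rightarrow> 'x set" where U: "\<And>i. i \<le> s \<Longrightarrow> U i \<in> sets X"
    "\<And>i. i \<le> s \<Longrightarrow> graph_finite (power_edges (space X) ?E k) (U i)" "space X = (\<Union>i\<le>s. U i)"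
    using spec[OF s, of k] by blast
  have U_less: "(\<Union>i<j. U i) \<in> sets X" if "j \<le> Suc s" for j
    using that U(1) by (intro sets.finite_UN) auto
  have "\<exists>c. borel_multimatching F (A \<inter> (\<Union>i<j. U i)) B (2 ^ (Suc s - j)) c" if "j \<le> Suc s" for j
    using that
  proof (induction j)
    case 0
    show ?case
      using F(1,2) by (auto simp: borel_multimatching_def borel_piecewise_translation_def piecewise_translation_on_def)
  next
    case (Suc j)
    \<comment> \<open>Removing the earlier sets makes the new points disjoint from the old ones;
      being inside \<open>U j\<close> makes their chain classes finite.\<close>
    define D where "D = A \<inter> U j - (\<Union>i<j. U i)"
    have j: "j \<le> s"
      using Suc.prems by simp
    have pow: "2 ^ (Suc s - j) = 2 * (2 ^ (s - j) :: nat)"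
      using j by (simp add: Suc_diff_le)
    obtain c where c: "borel_multimatching F (A \<inter> (\<Union>i<j. U i)) B (2 * 2 ^ (s - j)) c"
      using Suc.IH j unfolding pow by auto
    have D: "D \<in> sets X" "D \<subseteq> U j" "D \<subseteq> space X"
      using A U(1)[OF j] U_less[of j] j sets.sets_into_space[OF A] by (auto simp: D_def)
    have "\<exists>c'. borel_multimatching F (D \<union> A \<inter> (\<Union>i<j. U i)) B (2 ^ (s - j)) c'"
    proof (rule extend_borel_multimatching[OF F(1,2) D(1) B _ c])
      show "D \<inter> (A \<inter> (\<Union>i<j. U i)) = {}"
        by (auto simp: D_def)
      show "A \<inter> (\<Union>i<j. U i) \<in> sets X"
        using A U_less[of j] j by auto
      show "finite {y. chain ?T D x y}" if "x \<in> D" for x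
        using finite_chain[OF U(2)[OF j] D(2,3) k that] .
      fix K assume K: "finite K" "K \<subseteq> D"
      \<comment> \<open>The demand is greatest for \<open>j = 0\<close>, where it equals the factor
        for which \<open>F\<close> was chosen.\<close>
      have "2 * 2 ^ (s - j) * card K \<le> 2 ^ Suc s * card K"
        unfolding pow[symmetric] by (intro mult_le_mono1 power_increasing) auto
      also have "\<dots> \<le> card (translates F K \<inter> B)"
        using K by (intro F(3)) (auto simp: D_def)
      finally show "2 * 2 ^ (s - j) * card K \<le> card (translates F K \<inter> B)" .
    qed
    moreover have "D \<union> A \<inter> (\<Union>i<j. U i) = A \<inter> (\<Union>i<Suc j. U i)"
      by (auto simp: D_def less_Suc_eq)
    ultimately show ?case
      by simp
  qed
  from this[of "Suc s"] obtain c where "borel_multimatching F (A \<inter> (\<Union>i<Suc s. U i)) B 1 c"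
    by auto
  moreover have "A \<inter> (\<Union>i<Suc s. U i) = A"
    using sets.sets_into_space[OF A] U(3) by (auto simp: lessThan_Suc_atMost)
  ultimately have c: "borel_multimatching F A B 1 c"
    by simp
  then have "inj_on (\<lambda>(t, x). c t x) ({0} \<times> A)"
    by (simp add: borel_multimatching_def lessThan_Suc)
  then have "inj_on (c 0) A"
    by (auto simp: inj_on_def)
  moreover have "borel_piecewise_translation F A (c 0)" "c 0 ` A \<subseteq> B"
    using c by (auto simp: borel_multimatching_def)
  ultimately show ?thesis
    by blast
qed

lemma covered_imp_borel_matching:
  assumes S: "finite_generating_set \<Gamma> S"
    and asi: "asi_graph X (schreier_edges (space X) \<phi> S) < \<infinity>"
    and A: "A \<in> sets X" and B: "B \<in> sets X"
    and para: "paradoxical \<Gamma> \<phi> A \<or> paradoxical \<Gamma> \<phi> B"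
    and H: "finite H" "H \<subseteq> carrier \<Gamma>" "A \<subseteq> (\<Union>\<gamma>\<in>H. \<phi> \<gamma> ` B)"
  shows "\<exists>F f. borel_piecewise_translation F A f \<and> inj_on f A \<and> f ` A \<subseteq> B"
  by (rule borel_matching[OF S asi A B
        paradoxical_covered_expansion[OF sets.sets_into_space[OF A] sets.sets_into_space[OF B] para H]])

end

section \<open>The equivalences and the symmetric case\<close>

lemma borel_equidecomposable_imp_equidecomposable:
  "borel_equidecomposable \<Gamma> X \<phi> A B \<Longrightarrow> equidecomposable \<Gamma> \<phi> A B"
  by (auto simp: borel_equidecomposable_def equidecomposable_def)

theorem theorem1p31:
  fixes \<Gamma> :: "('g, 'm) monoid_scheme"
    and X :: "'x measure"
    and \<phi> :: "'g \<Rightarrow> 'x \<Rightarrow> 'x"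
    and A B :: "'x set"
  assumes "finitely_generated_group \<Gamma>"
    and "standard_borel_space X"
    and "borel_action \<Gamma> X \<phi>"
    and "asi_action \<Gamma> X \<phi> < \<infinity>"
    and "A \<in> sets X" and "B \<in> sets X"
    and "paradoxical \<Gamma> \<phi> A \<or> paradoxical \<Gamma> \<phi> B"
  shows "(subequivalent \<Gamma> \<phi> A B \<longleftrightarrow>
            (\<exists>B'\<in>sets X. B' \<subseteq> B \<and> borel_equidecomposable \<Gamma> X \<phi> A B'))
       \<and> ((\<exists>B'\<in>sets X. B' \<subseteq> B \<and> borel_equidecomposable \<Gamma> X \<phi> A B') \<longleftrightarrow>
            (\<exists>F. finite F \<and> F \<subseteq> carrier \<Gamma> \<and> A \<subseteq> (\<Union>\<gamma>\<in>F. \<phi> \<gamma> ` B)))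
       \<and> (equidecomposable \<Gamma> \<phi> A B \<longrightarrow> borel_equidecomposable \<Gamma> X \<phi> A B)"
proof -
  interpret group_action \<Gamma> "space X" \<phi>
    using assms(3) by (simp add: borel_action_def)
  obtain S where "group \<Gamma>" and S: "finite_generating_set \<Gamma> S"
    using assms(1) unfolding finitely_generated_group_def by blast
  have "countable (carrier \<Gamma>)"
    using group.countable_generate[OF \<open>group \<Gamma>\<close>, of S] S
    by (auto simp: finite_generating_set_def countable_finite)
  moreover obtain V where "\<And>n::nat. V n \<in> sets X"
    "\<And>x y. x \<in> space X \<Longrightarrow> y \<in> space X \<Longrightarrow> x \<noteq> y \<Longrightarrow> \<exists>n. (x \<in> V n) \<noteq> (y \<in> V n)"
    using standard_borel_separating_sequence[OF assms(2)] by blast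
  ultimately interpret separated_borel_action \<Gamma> X \<phi> V
    using assms(3) by unfold_locales (auto simp: borel_action_def)
  have asi: "asi_graph X (schreier_edges (space X) \<phi> S) < \<infinity>"
    using assms(4) asi_action_eq[OF group_action_axioms S] by simp
  note AX = sets.sets_into_space[OF assms(5)]
  let ?i = "subequivalent \<Gamma> \<phi> A B"
    and ?ii = "\<exists>B'\<in>sets X. B' \<subseteq> B \<and> borel_equidecomposable \<Gamma> X \<phi> A B'"
    and ?iii = "\<exists>F. finite F \<and> F \<subseteq> carrier \<Gamma> \<and> A \<subseteq> (\<Union>\<gamma>\<in>F. \<phi> \<gamma> ` B)"
  have "?iii" if ?i
  proof -
    obtain B' where "B' \<subseteq> B" and B': "equidecomposable \<Gamma> \<phi> A B'"
      using \<open>?i\<close> unfolding subequivalent_def by blast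
    obtain F where F: "finite F" "F \<subseteq> carrier \<Gamma>" "A \<subseteq> (\<Union>\<gamma>\<in>F. \<phi> \<gamma> ` B')"
      using equidecomposable_imp_covered[OF B' AX] by blast
    have "(\<Union>\<gamma>\<in>F. \<phi> \<gamma> ` B') \<subseteq> (\<Union>\<gamma>\<in>F. \<phi> \<gamma> ` B)"
      using \<open>B' \<subseteq> B\<close> by (intro UN_mono image_mono) auto
    with F show ?iii
      by (intro exI[of _ F] conjI) (auto intro: order_trans)
  qed
  moreover have "?ii" if ?iii
  proof -
    obtain H where "finite H" "H \<subseteq> carrier \<Gamma>" "A \<subseteq> (\<Union>\<gamma>\<in>H. \<phi> \<gamma> ` B)"
      using \<open>?iii\<close> by blast
    from covered_imp_borel_matching[OF S asi assms(5-7) this] obtain F f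
      where f: "borel_piecewise_translation F A f" "inj_on f A" "f ` A \<subseteq> B"
      by blast
    show ?ii
      using f(3) bpt_imp_borel_equidecomposable[OF f(1,2)] bpt_image_sets[OF f(1) assms(5)]
      by (intro bexI[of _ "f ` A"]) auto
  qed
  moreover have "?i" if ?ii
    using that borel_equidecomposable_imp_equidecomposable unfolding subequivalent_def by blast
  moreover have "borel_equidecomposable \<Gamma> X \<phi> A B" if AB: "equidecomposable \<Gamma> \<phi> A B"
  proof -
    obtain H where "finite H" "H \<subseteq> carrier \<Gamma>" "A \<subseteq> (\<Union>\<gamma>\<in>H. \<phi> \<gamma> ` B)"
      using equidecomposable_imp_covered[OF AB AX] by blast
    from covered_imp_borel_matching[OF S asi assms(5-7) this] obtain F f
      where f: "borel_piecewise_translation F A f" "inj_on f A" "f ` A \<subseteq> B"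
      by blast
    \<comment> \<open>The hypothesis is symmetric in the two sets, so the matching result also
      applies from \<open>B\<close> into \<open>A\<close>.\<close>
    have para: "paradoxical \<Gamma> \<phi> B \<or> paradoxical \<Gamma> \<phi> A"
      using assms(7) by blast
    obtain H' where "finite H'" "H' \<subseteq> carrier \<Gamma>" "B \<subseteq> (\<Union>\<gamma>\<in>H'. \<phi> \<gamma> ` A)"
      using equidecomposable_imp_covered_rev[OF AB] by blast
    from covered_imp_borel_matching[OF S asi assms(6,5) para this] obtain F' g
      where g: "borel_piecewise_translation F' B g" "inj_on g B" "g ` B \<subseteq> A"
      by blast
    show ?thesis
      using borel_schroeder_bernstein[OF f g] .
  qed
  ultimately show ?thesis
    by blast
qed

end
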